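(* Let $n\ge 1$ and $p,q\ge 0$ be integers, and let $\boldsymbol{x}=(x_1,\dots,x_n)$, $\boldsymbol{y}=(y_1,\dots,y_n)$, $\boldsymbol{z}=(z_1,\dots,z_{p+q})$, $\boldsymbol{a}=(a_1,\dots,a_n)$, $\boldsymbol{b}=(b_1,\dots,b_n)$, $\boldsymbol{c}=(c_1,\dots,c_{p+q})$ be indeterminates. Then $$ \det\left(\frac{F^{p+1,q+1}(x_i,y_j,\boldsymbol{z};a_i,b_j,\boldsymbol{c})}{(y_j-x_i)(1-x_iy_j)}\right)_{1\le i,j\le n} =\frac{(-1)^{n(n-1)/2}}{\prod_{i,j=1}^n (y_j-x_i)(1-x_iy_j)}\,F^{p,q}(\boldsymbol{z};\boldsymbol{c})^{\,n-1}\,F^{n+p,n+q}(\boldsymbol{x},\boldsymbol{y},\boldsymbol{z};\boldsymbol{a},\boldsymbol{b},\boldsymbol{c}). $$ Here $(x_i,y_j,\boldsymbol z)$ denotes the vector $(x_i,y_j,z_1,\dots,z_{p+q})$ of length $p+q+2$ (similarly for $(a_i,b_j,\boldsymbol c)$), and $(\boldsymbol x,\boldsymbol y,\boldsymbol z)$ denotes the concatenated vector of length $2n+p+q$ (similarly $(\boldsymbol a,\boldsymbol b,\boldsymbol c)$).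
   Context: Partitions: a partition $\lambda=(\lambda_1\ge\lambda_2\ge\cdots)$ of nonnegative integers with finitely many nonzero parts; $l(\lambda)$ is the number of nonzero parts, $|\lambda|=\sum_i\lambda_i$. In Frobenius notation $\lambda=(\alpha_1,\dots,\alpha_d\,|\,\beta_1,\dots,\beta_d)$ where $d=\#\{i:\lambda_i\ge i\}$, $\alpha_i=\lambda_i-i$, $\beta_i=\lambda'_i-i$ ($\lambda'$ the conjugate partition). For an integer $m\ge 0$, $\mathcal{P}_m$ is the set of partitions $\lambda$ with $l(\lambda)\le m$ of the form $(\alpha_1,\dots,\alpha_d\,|\,\alpha_1+1,\dots,\alpha_d+1)$ (the empty partition included; $|\lambda|$ is then even). For nonnegative integers $p,q$, vectors $\boldsymbol{x}=(x_1,\dots,x_{p+q})$, $\boldsymbol{a}=(a_1,\dots,a_{p+q})$, and partitions $\lambda,\mu$ with $l(\lambda)\le p$, $l(\mu)\le q$, let $V^{p,q}_{\lambda,\mu}(\boldsymbol{x};\boldsymbol{a})$ be the $(p+q)\times(p+q)$ matrix whose $i$-th row is $$(x_i^{\lambda_p},x_i^{\lambda_{p-1}+1},\dots,x_i^{\lambda_1+p-1},\ a_ix_i^{\mu_q},a_ix_i^{\mu_{q-1}+1},\dots,a_ix_i^{\mu_1+q-1}).$$ Define $$F^{p,q}(\boldsymbol{x};\boldsymbol{a})=\sum_{\lambda\in\mathcal{P}_p,\ \mu\in\mathcal{P}_q}(-1)^{(|\lambda|+|\mu|)/2}\det V^{p,q}_{\lambda,\mu}(\boldsymbol{x};\boldsymbol{a}),$$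 with the convention that $F^{0,0}=1$ (determinant of the empty matrix). *)

theory Defs
  imports "Jordan_Normal_Form.Determinant"
begin

definition is_partition :: "nat list \<Rightarrow> bool" where
  "is_partition lam \<longleftrightarrow> sorted_wrt (\<ge>) lam \<and> 0 \<notin> set lam"

definition part :: "nat list \<Rightarrow> nat \<Rightarrow> nat" where
  "part lam i = (if 1 \<le> i \<and> i \<le> length lam then lam ! (i - 1) else 0)"

definition conj_part :: "nat list \<Rightarrow> nat \<Rightarrow> nat" where
  "conj_part lam i = card {j. 1 \<le> j \<and> i \<le> part lam j}"

definition frob_rank :: "nat list \<Rightarrow> nat" where
  "frob_rank lam = card {i. 1 \<le> i \<and> i \<le> part lam i}"

definition frob_alpha :: "nat list \<Rightarrow> nat \<Rightarrow> int" where
  "frob_alpha lam i = int (part lam i) - int i"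

definition frob_beta :: "nat list \<Rightarrow> nat \<Rightarrow> int" where
  "frob_beta lam i = int (conj_part lam i) - int i"

definition Pset :: "nat \<Rightarrow> nat list set" where
  "Pset m = {lam. is_partition lam \<and> length lam \<le> m \<and>
      (\<forall>i. 1 \<le> i \<and> i \<le> frob_rank lam \<longrightarrow> frob_beta lam i = frob_alpha lam i + 1)}"

definition Vmat :: "nat \<Rightarrow> nat \<Rightarrow> nat list \<Rightarrow> nat list \<Rightarrow> (nat \<Rightarrow> 'a::comm_ring_1)
    \<Rightarrow> (nat \<Rightarrow> 'a) \<Rightarrow> 'a mat" where
  "Vmat p q lam mu x a = mat (p + q) (p + q) (\<lambda>(i, j).
      if j < p then x i ^ (part lam (p - j) + j)
      else a i * x i ^ (part mu (q - (j - p)) + (j - p)))"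

definition Ffun :: "nat \<Rightarrow> nat \<Rightarrow> (nat \<Rightarrow> 'a::comm_ring_1) \<Rightarrow> (nat \<Rightarrow> 'a) \<Rightarrow> 'a" where
  "Ffun p q x a = (\<Sum>lam\<in>Pset p. \<Sum>mu\<in>Pset q.
      (-1) ^ ((sum_list lam + sum_list mu) div 2) * det (Vmat p q lam mu x a))"

definition cons2 :: "'a \<Rightarrow> 'a \<Rightarrow> (nat \<Rightarrow> 'a) \<Rightarrow> nat \<Rightarrow> 'a" where
  "cons2 u v z k = (if k = 0 then u else if k = 1 then v else z (k - 2))"

definition concat3 :: "nat \<Rightarrow> (nat \<Rightarrow> 'a) \<Rightarrow> (nat \<Rightarrow> 'a) \<Rightarrow> (nat \<Rightarrow> 'a) \<Rightarrow> nat \<Rightarrow> 'a" where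
  "concat3 n x y z k = (if k < n then x k else if k < 2 * n then y (k - n) else z (k - 2 * n))"

end

theory Submission
  imports Defs
begin

text \<open>
  Summed over \<open>P\<^sub>p\<close> with signs, the exterior products \<open>x\<^bsup>\<lambda>\<^sub>p\<^esup> \<and> \<dots> \<and> x\<^bsup>\<lambda>\<^sub>1+p-1\<^esup>\<close> give
  \<open>(1 + x\<^bsup>2p-2\<^esup>) \<and> (x + x\<^bsup>2p-3\<^esup>) \<and> \<dots> \<and> x\<^bsup>p-1\<^esup>\<close>, which has the same value as the product of
  \<open>x\<^sup>j (1 + x\<^sup>2)\<^bsup>p-1-j\<^esup>\<close>, \<open>j < p\<close>. Hence \<open>F\<^bsup>p,q\<^esup>\<close> is a single determinant, whose rows are the
  monomials of degrees \<open>p - 1\<close> and \<open>q - 1\<close> in \<open>s = x\<close> and \<open>t = 1 + x\<^sup>2\<close>, those of the second kind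
  multiplied by \<open>a\<close>. The denominator \<open>(y - x)(1 - xy)\<close> is the bracket \<open>s(y) t(x) - t(y) s(x)\<close>.

  In this homogeneous form, the function \<open>w \<mapsto> F(w, y\<^sub>j, z) \<Prod>\<^bsub>k\<noteq>j\<^esub> [w, y\<^sub>k]\<close> is a linear form in the row
  that the point \<open>w\<close> contributes to \<open>F\<^bsup>n+p,n+q\<^esup>\<close>, and it vanishes on the rows of all \<open>y\<^sub>k\<close> and \<open>z\<^sub>k\<close>. So the
  determinant of its values at \<open>x\<^sub>1, \<dots>, x\<^sub>n\<close> is a constant multiple of \<open>F\<^bsup>n+p,n+q\<^esup>(x, y, z)\<close>. The constant is
  found at \<open>x\<^sub>i = y\<^sub>i\<close> with \<open>a\<^sub>i = b\<^sub>i + 1\<close>, where both sides factor. This needs \<open>y\<close> and \<open>z\<close> in general position;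
  the general case follows by specialising a polynomial parameter.
\<close>

section \<open>Determinants as functions of their columns\<close>

text \<open>Columns are functions of the row index and the list length fixes the size, so blocks of
  columns can be concatenated, split and moved without tracking dimensions.\<close>

definition col_det :: "(nat \<Rightarrow> 'a::comm_ring_1) list \<Rightarrow> 'a" where
  "col_det us = det (mat (length us) (length us) (\<lambda>(i, j). (us ! j) i))"

text \<open>Laplace expansion along the column in question: its cofactors do not see that column, so
  they can be computed with the zero column in its place.\<close>

lemma col_det_linear:
  assumes "finite S"
  shows "col_det (as @ (\<lambda>i. \<Sum>k\<in>S. d k * f k i) # bs) = (\<Sum>k\<in>S. d k * col_det (as @ f k # bs))"
proof -
  let ?l = "length as" and ?n = "length as + Suc (length bs)"
  define M where "M u = mat ?n ?n (\<lambda>(i, j). ((as @ u # bs) ! j) i)" for u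
  have cd: "col_det (as @ u # bs) = (\<Sum>i<?n. u i * cofactor (M (\<lambda>_. 0)) i ?l)" for u
  proof -
    have "cofactor (M u) i ?l = cofactor (M (\<lambda>_. 0)) i ?l" if "i < ?n" for i
    proof -
      have "mat_delete (M u) i ?l = mat_delete (M (\<lambda>_. 0)) i ?l"
        by (rule eq_matI) (auto simp: mat_delete_def M_def nth_append)
      then show ?thesis by (simp add: cofactor_def)
    qed
    moreover have "col_det (as @ u # bs) = det (M u)"
      by (simp add: col_det_def M_def)
    moreover have "M u \<in> carrier_mat ?n ?n" by (simp add: M_def)
    ultimately show ?thesis
      by (subst laplace_expansion_column[of "M u" ?n ?l, THEN trans[OF \<open>col_det _ = _\<close>]])
        (auto simp: M_def intro!: sum.cong)
  qed
  show ?thesis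
    unfolding cd sum_distrib_left sum_distrib_right
    by (subst sum.swap) (simp add: mult.assoc)
qed

lemma col_det_dup:
  assumes "u \<in> set as \<union> set bs"
  shows "col_det (as @ u # bs) = 0"
proof -
  let ?us = "as @ u # bs" and ?l = "length as"
  obtain j where j: "j \<noteq> ?l" "j < length ?us" "?us ! j = u"
  proof -
    from assms consider k where "k < length as" "as ! k = u" | k where "k < length bs" "bs ! k = u"
      by (auto simp: in_set_conv_nth)
    then show ?thesis
    proof cases
      case 1 then show ?thesis using that[of k] by (auto simp: nth_append)
    next
      case 2 then show ?thesis using that[of "Suc ?l + k"] by (auto simp: nth_append)
    qed
  qed
  show ?thesis unfolding col_det_def
    by (rule det_identical_columns[of _ "length ?us" ?l j]) (use j in \<open>auto simp: col_def\<close>)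
qed

lemma col_det_swap: "col_det (as @ u # v # bs) = - col_det (as @ v # u # bs)"
proof -
  let ?us = "as @ v # u # bs" and ?l = "length as"
  let ?n = "length ?us"
  let ?A = "mat ?n ?n (\<lambda>(i, j). (?us ! j) i)"
  have "col_det (as @ u # v # bs) = det (swapcols ?l (Suc ?l) ?A)"
    unfolding col_det_def
    by (rule arg_cong[of _ _ det], rule eq_matI) (auto simp: nth_append nth_Cons')
  also have "\<dots> = - det ?A"
    by (rule det_swapcols[of _ ?n]) auto
  finally show ?thesis by (simp add: col_det_def)
qed

lemma col_det_move:
  "col_det (as @ u # vs @ bs) = (-1) ^ length vs * col_det (as @ vs @ u # bs)"
proof (induction vs arbitrary: as)
  case (Cons v vs)
  show ?case using Cons[of "as @ [v]"] col_det_swap[of as u v "vs @ bs"] by simp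
qed simp

section \<open>Palindromic polynomials in terms of \<open>x^j (1 + x^2)^(m-j)\<close>\<close>

text \<open>Used to trade the column \<open>(1 + x^2)^(p+1)\<close> for the monomials
  \<open>1\<close> and \<open>x^(2p+2)\<close> modulo the other columns of its block. The
  coefficients \<open>d\<close> are quantified before \<open>x\<close> because a column operation
  uses the same ones in every row.\<close>

lemma binomial_pair_expansion:
  "\<exists>d :: nat \<Rightarrow> 'a::comm_ring_1. \<forall>x. (1 + x\<^sup>2) ^ Suc p
      = 1 + x ^ (2 * Suc p) + (\<Sum>j\<le>p. d j * (x ^ Suc j * (1 + x\<^sup>2) ^ (p - j)))"
proof -
  define P where "P m d \<longleftrightarrow> (\<forall>x::'a. 1 + x ^ (2 * m) = (\<Sum>j\<le>m. d j * (x ^ j * (1 + x\<^sup>2) ^ (m - j))))"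
    for m and d :: "nat \<Rightarrow> 'a"
  \<comment> \<open>Coefficient form of
    \<open>1 + x^(2m+4) = (1 + x^2)(1 + x^(2m+2)) - x^2 (1 + x^(2m))\<close>.\<close>
  have step: "P (m + 2) (\<lambda>j. (if j \<le> m + 1 then e j else 0) - (if j < 2 then 0 else d (j - 2)))"
    if d: "P m d" and e: "P (m + 1) e" for m d e
    unfolding P_def
  proof
    fix x :: 'a
    have 1: "(\<Sum>j\<le>m+2. (if j \<le> m + 1 then e j else 0) * (x ^ j * (1 + x\<^sup>2) ^ (m + 2 - j)))
        = (1 + x\<^sup>2) * (1 + x ^ (2 * (m + 1)))"
    proof -
      have "(\<Sum>j\<le>m+2. (if j \<le> m + 1 then e j else 0) * (x ^ j * (1 + x\<^sup>2) ^ (m + 2 - j)))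
        = (\<Sum>j\<le>m+1. e j * (x ^ j * (1 + x\<^sup>2) ^ (m + 2 - j)))"
        by simp
      also have "\<dots> = (\<Sum>j\<le>m+1. (1 + x\<^sup>2) * (e j * (x ^ j * (1 + x\<^sup>2) ^ (m + 1 - j))))"
      proof (rule sum.cong[OF refl])
        fix j assume "j \<in> {..m + 1}"
        then have "m + 2 - j = Suc (m + 1 - j)" by auto
        then show "e j * (x ^ j * (1 + x\<^sup>2) ^ (m + 2 - j))
            = (1 + x\<^sup>2) * (e j * (x ^ j * (1 + x\<^sup>2) ^ (m + 1 - j)))"
          by (simp add: mult_ac)
      qed
      also have "\<dots> = (1 + x\<^sup>2) * (1 + x ^ (2 * (m + 1)))"
        using e by (simp only: P_def sum_distrib_left[symmetric])
      finally show ?thesis .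
    qed
    have 2: "(\<Sum>j\<le>m+2. (if j < 2 then 0 else d (j - 2)) * (x ^ j * (1 + x\<^sup>2) ^ (m + 2 - j)))
        = x\<^sup>2 * (1 + x ^ (2 * m))"
    proof -
      have "(\<Sum>j\<le>m+2. (if j < 2 then 0 else d (j - 2)) * (x ^ j * (1 + x\<^sup>2) ^ (m + 2 - j)))
        = (\<Sum>j\<le>m. d j * (x ^ (j + 2) * (1 + x\<^sup>2) ^ (m - j)))"
        by (simp add: sum.atMost_Suc_shift numeral_2_eq_2 del: sum.atMost_Suc)
      also have "\<dots> = x\<^sup>2 * (\<Sum>j\<le>m. d j * (x ^ j * (1 + x\<^sup>2) ^ (m - j)))"
        by (simp add: sum_distrib_left power_add power2_eq_square mult_ac)
      finally show ?thesis using d unfolding P_def by simp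
    qed
    have "1 + x ^ (2 * (m + 2)) = (1 + x\<^sup>2) * (1 + x ^ (2 * (m + 1))) - x\<^sup>2 * (1 + x ^ (2 * m))"
      by (simp add: algebra_simps power_add power2_eq_square numeral_eq_Suc)
    also have "\<dots> = (\<Sum>j\<le>m+2. ((if j \<le> m + 1 then e j else 0) - (if j < 2 then 0 else d (j - 2)))
           * (x ^ j * (1 + x\<^sup>2) ^ (m + 2 - j)))"
      unfolding 1[symmetric] 2[symmetric] by (simp only: sum_subtractf left_diff_distrib)
    finally show "1 + x ^ (2 * (m + 2)) = (\<Sum>j\<le>m+2.
      ((if j \<le> m + 1 then e j else 0) - (if j < 2 then 0 else d (j - 2)))
           * (x ^ j * (1 + x\<^sup>2) ^ (m + 2 - j)))" .
  qed
  \<comment> \<open>The recurrence needs two consecutive values. The normalisation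
    \<open>e 0 = 1\<close>, which later isolates the pure power of \<open>1 + x^2\<close>, is
    claimed only for the second one: for \<open>m = 0\<close> the first has coefficient 2.\<close>
  have "\<exists>d e. P m d \<and> P (m + 1) e \<and> e 0 = 1" for m
  proof (induction m)
    case 0
    have "P 0 (\<lambda>_. 2)" "P (0 + 1) (\<lambda>j. if j = 0 then 1 else 0)" by (auto simp: P_def)
    then show ?case by (metis (mono_tags, lifting))
  next
    case (Suc m)
    then obtain d e where de: "P m d" "P (m + 1) e" "e 0 = 1" by blast
    from step[OF de(1,2)] de(2,3) show ?case
      by (intro exI[of _ e] exI[of _ "\<lambda>j. (if j \<le> m + 1 then e j else 0) - (if j < 2 then 0 else d (j - 2))"])
        simp
  qed
  then obtain e where e: "P (Suc p) e" "e 0 = 1" by (metis Suc_eq_plus1)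
  have "(1 + x\<^sup>2) ^ Suc p
      = 1 + x ^ (2 * Suc p) + (\<Sum>j\<le>p. - e (Suc j) * (x ^ Suc j * (1 + x\<^sup>2) ^ (p - j)))" for x
  proof -
    have "1 + x ^ (2 * Suc p) = (\<Sum>j\<le>Suc p. e j * (x ^ j * (1 + x\<^sup>2) ^ (Suc p - j)))"
      using e(1) by (simp only: P_def)
    then show ?thesis using e(2)
      by (subst (asm) sum.atMost_Suc_shift) (simp add: sum_negf)
  qed
  then show ?thesis by (intro exI[of _ "\<lambda>j. - e (Suc j)"]) blast
qed

section \<open>The partitions in \<open>P\<^sub>p\<close>\<close>

lemma part_Nil [simp]: "part [] j = 0"
  by (simp add: part_def)

lemma part_Cons: "part (k # ks) j = (if j = 0 then 0 else if j = 1 then k else part ks (j - 1))"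
  by (auto simp: part_def nth_Cons')

lemma part_eq_0: "length lam < j \<Longrightarrow> part lam j = 0"
  by (simp add: part_def)

lemma part_nth: "i < length lam \<Longrightarrow> part lam (Suc i) = lam ! i"
  by (simp add: part_def)

lemma part_pos_iff: "is_partition lam \<Longrightarrow> 0 < part lam j \<longleftrightarrow> 1 \<le> j \<and> j \<le> length lam"
  by (auto simp: part_def is_partition_def in_set_conv_nth)

lemma part_antimono:
  assumes "is_partition lam" "1 \<le> i" "i \<le> j"
  shows "part lam j \<le> part lam i"
proof (cases "i = j \<or> length lam < j")
  case False
  then show ?thesis
    using assms sorted_wrt_nth_less[of "(\<ge>)" lam "i - 1" "j - 1"]
    by (auto simp: part_def is_partition_def)
qed (use part_eq_0 in auto)

lemma partition_eqI:
  assumes "is_partition lam" "is_partition mu" "\<And>j. part lam j = part mu j"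
  shows "lam = mu"
proof -
  have "j \<le> length lam \<longleftrightarrow> j \<le> length mu" if "1 \<le> j" for j
    using part_pos_iff[OF assms(1), of j] part_pos_iff[OF assms(2), of j] assms(3)[of j] that by simp
  then have len: "length lam = length mu"
    by (metis Suc_leI le_eq_less_or_eq less_or_eq_imp_le linorder_neqE_nat not_less_eq_eq One_nat_def le0 nat_neq_iff)
  show ?thesis
  proof (rule nth_equalityI[OF len])
    fix i assume "i < length lam"
    then show "lam ! i = mu ! i" using assms(3)[of "Suc i"] len by (simp add: part_nth)
  qed
qed

lemma sum_list_eq_sum_part:
  assumes "length lam \<le> p"
  shows "sum_list lam = (\<Sum>j<p. part lam (Suc j))"
proof -
  have "(\<Sum>j<p. part lam (Suc j)) = (\<Sum>j<length lam. part lam (Suc j))"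
    by (rule sum.mono_neutral_right) (use assms in \<open>auto simp: part_eq_0\<close>)
  also have "\<dots> = sum_list lam"
    by (simp add: sum_list_sum_nth part_nth atLeast0LessThan)
  finally show ?thesis by simp
qed

lemma finite_conj_part_set: "1 \<le> i \<Longrightarrow> finite {j. 1 \<le> j \<and> i \<le> part lam j}"
  by (rule finite_subset[of _ "{..length lam}"]) (auto simp: part_def split: if_splits)

lemma conj_part_1:
  assumes "is_partition lam"
  shows "conj_part lam 1 = length lam"
proof -
  have "1 \<le> part lam j \<longleftrightarrow> 1 \<le> j \<and> j \<le> length lam" for j
    using part_pos_iff[OF assms, of j] by linarith
  then have "{j. 1 \<le> j \<and> 1 \<le> part lam j} = {1..length lam}"
    by (simp only: set_eq_iff mem_Collect_eq atLeastAtMost_iff) blast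
  then show ?thesis by (simp add: conj_part_def)
qed

text \<open>Parts decrease while \<open>i\<close> increases, so the diagonal positions form an
  initial segment, determined by its cardinality.\<close>

lemma le_frob_rank_iff:
  assumes "is_partition lam" "1 \<le> i"
  shows "i \<le> frob_rank lam \<longleftrightarrow> i \<le> part lam i"
proof -
  define S where "S = {i. 1 \<le> i \<and> i \<le> part lam i}"
  have fin: "finite S" unfolding S_def
    by (rule finite_subset[of _ "{..length lam}"]) (auto simp: part_def split: if_splits)
  have down: "k \<in> S" if "1 \<le> k" "k \<le> m" "m \<in> S" for k m
    using part_antimono[OF assms(1) that(1,2)] that by (auto simp: S_def)
  have "S = {1..card S}"
  proof (cases "S = {}")
    case False
    then have "S = {1..Max S}"
      using down[OF _ _ Max_in[OF fin False]] Max_ge[OF fin] by (auto simp: S_def)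
    then show ?thesis by (metis card_atLeastAtMost diff_Suc_1)
  qed simp
  then have "i \<in> S \<longleftrightarrow> i \<le> card S" using assms(2) by (metis atLeastAtMost_iff)
  then show ?thesis using assms(2) by (simp add: S_def frob_rank_def)
qed

text \<open>Cancelling \<open>i\<close> from both Frobenius coordinates leaves a condition on row
  and column lengths alone, with the rank replaced by a test at each diagonal position.\<close>

lemma Pset_iff:
  "lam \<in> Pset m \<longleftrightarrow> is_partition lam \<and> length lam \<le> m \<and>
    (\<forall>i\<ge>1. i \<le> part lam i \<longrightarrow> conj_part lam i = part lam i + 1)"
proof (cases "is_partition lam")
  case True
  have "int k - int i = int l - int i + 1 \<longleftrightarrow> k = l + 1" for k l i by linarith
  then show ?thesis using le_frob_rank_iff[OF True] True
    unfolding Pset_def frob_beta_def frob_alpha_def by auto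
qed (simp add: Pset_def)

text \<open>If \<open>lam\<close> is nonempty, its first column has \<open>part lam 1 + 1\<close>
  boxes, which is at most \<open>p\<close>.\<close>

lemma Pset_part_less:
  assumes "lam \<in> Pset p" "1 \<le> p" "1 \<le> j"
  shows "part lam j < p"
proof -
  have lam: "is_partition lam" "length lam \<le> p" using assms(1) by (auto simp: Pset_iff)
  have "part lam 1 < p"
  proof (cases "1 \<le> part lam 1")
    case True
    then have "length lam = part lam 1 + 1"
      using assms(1) conj_part_1[OF lam(1)] by (auto simp: Pset_iff)
    then show ?thesis using lam by simp
  qed (use assms in simp)
  then show ?thesis using part_antimono[OF lam(1) _ assms(3)] by (meson le_less_trans order_refl)
qed

text \<open>On Frobenius coordinates, \<open>hook_ext p\<close> prepends \<open>p - 1\<close> to the arms and \<open>p\<close> to the legs of a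
  partition with at most \<open>p\<close> parts.\<close>

definition hook_ext :: "nat \<Rightarrow> nat list \<Rightarrow> nat list" where
  "hook_ext p lam = p # map (\<lambda>j. Suc (part lam (Suc j))) [0..<p]"

lemma part_hook_ext:
  "part (hook_ext p lam) (Suc j) =
    (if j = 0 then p else if j \<le> p then Suc (part lam j) else 0)"
  by (auto simp: hook_ext_def part_Cons part_def)

text \<open>Column \<open>i + 1\<close> of the extension meets the new first row, of length
  \<open>p > i\<close>, and the shifted rows of \<open>lam\<close> that reach column
  \<open>i\<close>.\<close>

lemma conj_part_hook_ext:
  assumes "length lam \<le> p" "1 \<le> i" "i < p"
  shows "conj_part (hook_ext p lam) (Suc i) = Suc (conj_part lam i)"
proof -
  let ?S = "{j. 1 \<le> j \<and> i \<le> part lam j}"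
  have "j \<in> {j. 1 \<le> j \<and> Suc i \<le> part (hook_ext p lam) j} \<longleftrightarrow> j \<in> insert 1 (Suc ` ?S)" for j
  proof (cases j)
    case (Suc k)
    then show ?thesis using assms part_eq_0[of lam k] by (auto simp: part_hook_ext not_le)
  qed auto
  then have "{j. 1 \<le> j \<and> Suc i \<le> part (hook_ext p lam) j} = insert 1 (Suc ` ?S)" by blast
  moreover have "card (insert 1 (Suc ` ?S)) = Suc (card (Suc ` ?S))"
    using finite_conj_part_set[OF assms(2), of lam] by (intro card_insert_disjoint) auto
  ultimately show ?thesis
    by (simp add: conj_part_def card_image)
qed

text \<open>The new hook has arm \<open>p - 1\<close> and leg \<open>p\<close>, and the later
  diagonal hooks are those of \<open>lam\<close>. For \<open>p = 0\<close> the list would be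
  \<open>[0]\<close>, which is no partition in this encoding.\<close>

lemma hook_ext_in_Pset:
  assumes "lam \<in> Pset p" "1 \<le> p"
  shows "hook_ext p lam \<in> Pset (Suc p)"
proof -
  have lam: "is_partition lam" "length lam \<le> p" using assms(1) by (auto simp: Pset_iff)
  have less: "part lam j < p" if "1 \<le> j" for j using Pset_part_less[OF assms that] .
  have P: "is_partition (hook_ext p lam)"
    unfolding is_partition_def hook_ext_def
    using assms(2) less part_antimono[OF lam(1)]
    by (auto simp: sorted_wrt_map sorted_wrt_iff_nth_less[of _ "[0..<p]"] Suc_le_eq less_Suc_eq_le)
  have "conj_part (hook_ext p lam) i = part (hook_ext p lam) i + 1"
    if i: "1 \<le> i" "i \<le> part (hook_ext p lam) i" for i
  proof (cases "i = 1")
    case True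
    then show ?thesis using conj_part_1[OF P] part_hook_ext[of p lam 0] by (simp add: hook_ext_def)
  next
    case False
    then obtain k where k: "i = Suc k" "1 \<le> k" using i by (cases i) auto
    then have "k \<le> p" "k \<le> part lam k"
      using i by (auto simp: part_hook_ext split: if_splits)
    moreover then have "k < p" using less[OF k(2)] by simp
    ultimately show ?thesis
      using k assms(1) conj_part_hook_ext[OF lam(2) k(2)] by (auto simp: Pset_iff part_hook_ext)
  qed
  then show ?thesis using P by (simp add: Pset_iff hook_ext_def)
qed

lemma part_filter_nonzero:
  "sorted_wrt (\<ge>) ks \<Longrightarrow> part (filter (\<lambda>k. k \<noteq> 0) ks) j = part ks j"
proof (induction ks arbitrary: j)
  case (Cons k ks)
  show ?case
  proof (cases "k = 0")
    case True
    then have "\<forall>i\<in>set ks. i = 0" using Cons.prems by auto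
    then have "part ks m = 0" "filter (\<lambda>k. k \<noteq> 0) ks = []" for m by (auto simp: part_def)
    then show ?thesis using True by (simp add: part_Cons)
  qed (use Cons in \<open>simp add: part_Cons\<close>)
qed simp

text \<open>Such a partition has exactly \<open>p + 1\<close> parts, so its first hook has leg
  \<open>p\<close> and hence arm \<open>p - 1\<close>. This is the hook that
  \<open>hook_ext p\<close> adds, and peeling it off gives the preimage.\<close>

lemma Pset_Suc_cases:
  assumes "lam \<in> Pset (Suc p)" "1 \<le> p" "lam \<notin> Pset p"
  shows "lam \<in> hook_ext p ` Pset p"
proof -
  have lam: "is_partition lam" "length lam = Suc p" using assms by (auto simp: Pset_iff)
  have "conj_part lam 1 = part lam 1 + 1"
    using assms(1) part_pos_iff[OF lam(1), of 1] lam(2) by (simp add: Pset_iff Suc_le_eq)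
  then have p1: "part lam 1 = p" using conj_part_1[OF lam(1)] lam(2) by simp
  \<comment> \<open>First row and first column are deleted. Rows of length 1 become 0 and are
    filtered out below.\<close>
  define ks where "ks = map (\<lambda>j. part lam (Suc (Suc j)) - 1) [0..<p]"
  have sks: "sorted_wrt (\<ge>) ks"
    unfolding ks_def using part_antimono[OF lam(1)]
    by (auto simp: sorted_wrt_iff_nth_less intro!: diff_le_mono)
  define mu where "mu = filter (\<lambda>k. k \<noteq> 0) ks"
  have mu: "is_partition mu" unfolding is_partition_def mu_def
    using sks by (auto intro: sorted_wrt_filter)
  have lmu: "length mu \<le> p" unfolding mu_def ks_def by (metis diff_zero length_filter_le length_map length_upt)
  have pmu: "part mu j = part lam (Suc j) - 1" if "1 \<le> j" for j
  proof -
    have "part mu j = part ks j" unfolding mu_def using sks by (rule part_filter_nonzero)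
    also have "\<dots> = part lam (Suc j) - 1"
      using that lam(2) by (cases j) (auto simp: part_def ks_def)
    finally show ?thesis .
  qed
  have eq: "hook_ext p mu = lam"
  proof (rule nth_equalityI)
    fix i assume "i < length (hook_ext p mu)"
    then have i: "i \<le> p" by (simp add: hook_ext_def)
    have "hook_ext p mu ! i = part (hook_ext p mu) (Suc i)"
      using i by (simp add: part_nth hook_ext_def)
    also have "\<dots> = part lam (Suc i)"
      using i p1 pmu[of i] part_pos_iff[OF lam(1), of "Suc i"] lam(2) by (auto simp: part_hook_ext)
    finally show "hook_ext p mu ! i = lam ! i" using i lam(2) by (simp add: part_nth)
  qed (simp add: lam(2) hook_ext_def)
  have "conj_part mu i = part mu i + 1" if i: "1 \<le> i" "i \<le> part mu i" for i
  proof -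
    have "part lam (Suc i) \<le> p" using part_antimono[OF lam(1), of 1 "Suc i"] p1 by simp
    then have "i < p" "Suc i \<le> part lam (Suc i)" using i pmu[OF i(1)] assms(2) by auto
    moreover from this(2) have "conj_part lam (Suc i) = part lam (Suc i) + 1"
      using assms(1) by (simp add: Pset_iff)
    ultimately show ?thesis
      using conj_part_hook_ext[OF lmu i(1)] pmu[OF i(1)] by (simp add: eq)
  qed
  then have "mu \<in> Pset p" using mu lmu by (simp add: Pset_iff)
  then show ?thesis using eq by blast
qed

lemma Pset_Suc:
  assumes "1 \<le> p"
  shows "Pset (Suc p) = Pset p \<union> hook_ext p ` Pset p"
proof
  show "Pset (Suc p) \<subseteq> Pset p \<union> hook_ext p ` Pset p"
    using Pset_Suc_cases[OF _ assms] by blast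
  show "Pset p \<union> hook_ext p ` Pset p \<subseteq> Pset (Suc p)"
    using hook_ext_in_Pset[OF _ assms] by (auto simp: Pset_iff)
qed

lemma Pset_disjoint_hook_ext: "Pset p \<inter> hook_ext p ` Pset p = {}"
  by (auto simp: Pset_iff hook_ext_def)

lemma inj_on_hook_ext: "inj_on (hook_ext p) (Pset p)"
proof (rule inj_onI)
  fix lam mu assume *: "lam \<in> Pset p" "mu \<in> Pset p" "hook_ext p lam = hook_ext p mu"
  show "lam = mu"
  proof (rule partition_eqI)
    show "is_partition lam" "is_partition mu" using * by (auto simp: Pset_iff)
    show "part lam j = part mu j" for j
    proof (cases "1 \<le> j \<and> j \<le> p")
      case True
      then show ?thesis
        using part_hook_ext[of p lam j] part_hook_ext[of p mu j] *(3) by simp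
    next
      case False
      then show ?thesis using * by (auto simp: Pset_iff part_def)
    qed
  qed
qed

text \<open>The \<open>2 * p\<close> extra boxes change the sign by \<open>(-1)^p\<close>, which
  will pay for moving one column past \<open>p\<close> others.\<close>

lemma sum_list_hook_ext:
  "length lam \<le> p \<Longrightarrow> sum_list (hook_ext p lam) = 2 * p + sum_list lam"
  by (simp add: hook_ext_def sum_list_eq_sum_part[of lam p] interv_sum_list_conv_sum_set_nat
      atLeast0LessThan sum.distrib[symmetric] sum_Suc)

lemma Pset_0: "Pset 0 = {[]}"
  by (auto simp: Pset_iff is_partition_def)

lemma Pset_1: "Pset (Suc 0) = {[]}"
proof -
  have "lam = []" if "lam \<in> Pset (Suc 0)" for lam
  proof (rule ccontr)
    assume "lam \<noteq> []"
    moreover have lam: "is_partition lam" "length lam \<le> 1" using that by (auto simp: Pset_iff)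
    moreover have "part lam 1 < 1" using Pset_part_less[OF that, of 1] by simp
    ultimately show False using part_pos_iff[OF lam(1), of 1] by (cases lam) auto
  qed
  moreover have "[] \<in> Pset (Suc 0)" by (auto simp: Pset_iff is_partition_def)
  ultimately show ?thesis by blast
qed

text \<open>Evenness makes the halved sizes in the signs additive.\<close>

lemma Pset_finite_even: "finite (Pset p) \<and> (\<forall>lam\<in>Pset p. even (sum_list lam))"
proof (induction p)
  case (Suc p)
  show ?case
  proof (cases "1 \<le> p")
    case True
    show ?thesis unfolding Pset_Suc[OF True] using Suc
      by (auto simp: sum_list_hook_ext Pset_iff)
  next
    case False
    then have "Pset (Suc p) = {[]}" using Pset_1 by (simp add: not_le)
    then show ?thesis by simp
  qed
qed (simp add: Pset_0)

section \<open>Signed sums over \<open>Pset p\<close> as single determinants\<close>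

text \<open>Induction on \<open>p\<close> along \<open>Pset_Suc\<close>. The weight \<open>a\<close>
  is arbitrary because dropping the first column from a block of size \<open>p + 1\<close> leaves a
  block of size \<open>p\<close> with weight \<open>a i * x i\<close>; \<open>as\<close> and
  \<open>bs\<close> hold the dropped columns and the other block.\<close>

lemma col_det_Pset:
  fixes x a :: "nat \<Rightarrow> 'a::comm_ring_1"
  shows "col_det (as @ map (\<lambda>j i. a i * (x i ^ j * (1 + (x i)\<^sup>2) ^ (p - 1 - j))) [0..<p] @ bs)
    = (\<Sum>lam\<in>Pset p. (-1) ^ (sum_list lam div 2) *
        col_det (as @ map (\<lambda>j i. a i * x i ^ (part lam (p - j) + j)) [0..<p] @ bs))"
proof (induction p arbitrary: as a)
  case 0
  then show ?case by (simp add: Pset_0)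
next
  case (Suc p)
  show ?case
  proof (cases "p = 0")
    case True
    then show ?thesis by (simp add: Pset_1)
  next
    case False
    then have p: "1 \<le> p" by simp
    let ?e = "\<lambda>k i. a i * x i ^ k"
    define ws where "ws = map (\<lambda>j i. (a i * x i) * (x i ^ j * (1 + (x i)\<^sup>2) ^ (p - 1 - j))) [0..<p]"
    let ?vs = "\<lambda>lam. map (\<lambda>j i. (a i * x i) * x i ^ (part lam (p - j) + j)) [0..<p]"
    let ?us = "\<lambda>lam. map (\<lambda>j i. a i * x i ^ (part lam (Suc p - j) + j)) [0..<Suc p]"
    let ?sg = "\<lambda>lam. (-1) ^ (sum_list lam div 2) :: 'a"
    have upt: "[0..<Suc p] = 0 # map Suc [0..<p]"
      by (simp add: map_Suc_upt upt_conv_Cons)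
    obtain m where m: "p = Suc m" using p by (cases p) auto
    obtain d where d: "\<And>y::'a. (1 + y\<^sup>2) ^ p
      = 1 + y ^ (2 * p) + (\<Sum>j\<le>m. d j * (y ^ Suc j * (1 + y\<^sup>2) ^ (m - j)))"
      using binomial_pair_expansion[of m, where 'a = 'a] unfolding m by blast
    \<comment> \<open>The entries below \<open>p\<close> repeat columns of \<open>ws\<close>, so
      their determinants vanish; only the monomials \<open>1\<close> and \<open>x^(2p)\<close>, at
      positions \<open>p\<close> and \<open>p + 1\<close>, survive.\<close>
    define f where "f k = (if k = p then ?e 0 else if k = Suc p then ?e (2 * p) else ws ! k)" for k
    define c where "c k = (if k < p then d k else 1)" for k
    have "(\<lambda>i. a i * (1 + (x i)\<^sup>2) ^ p) = (\<lambda>i. \<Sum>k<p + 2. c k * f k i)"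
    proof
      fix i
      have "(\<Sum>k<p + 2. c k * f k i) = (\<Sum>k<p. d k * (ws ! k) i) + a i + a i * x i ^ (2 * p)"
        by (simp add: c_def f_def)
      also have "(\<Sum>k<p. d k * (ws ! k) i)
          = a i * (\<Sum>j\<le>m. d j * (x i ^ Suc j * (1 + (x i)\<^sup>2) ^ (m - j)))"
        unfolding sum_distrib_left
        by (rule sum.cong) (auto simp: m ws_def mult_ac simp del: upt_Suc)
      finally show "a i * (1 + (x i)\<^sup>2) ^ p = (\<Sum>k<p + 2. c k * f k i)"
        unfolding d by (simp add: algebra_simps)
    qed
    then have "col_det (as @ (\<lambda>i. a i * (1 + (x i)\<^sup>2) ^ p) # ws @ bs)
        = (\<Sum>k<p + 2. c k * col_det (as @ f k # ws @ bs))"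
      by (simp only: col_det_linear[OF finite_lessThan])
    also have "\<dots> = col_det (as @ ?e 0 # ws @ bs) + col_det (as @ ?e (2 * p) # ws @ bs)"
    proof -
      have "col_det (as @ f k # ws @ bs) = 0" if "k < p" for k
        using that by (intro col_det_dup) (auto simp: f_def ws_def)
      then show ?thesis by (simp add: c_def f_def)
    qed
    finally have 1: "col_det (as @ (\<lambda>i. a i * (1 + (x i)\<^sup>2) ^ p) # ws @ bs) = \<dots>" .
    have 2: "col_det (as @ ?e k # ws @ bs) = (\<Sum>lam\<in>Pset p. ?sg lam * col_det (as @ ?e k # ?vs lam @ bs))" for k
      using Suc.IH[of "as @ [?e k]" "\<lambda>i. a i * x i"] by (simp add: ws_def)
    \<comment> \<open>The part with index \<open>p + 1\<close> of a member of \<open>Pset p\<close>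
      is 0, so the constant monomial is already its first column.\<close>
    have 3: "?e 0 # ?vs lam = ?us lam" if "lam \<in> Pset p" for lam
      unfolding upt using that part_eq_0[of lam "Suc p"] by (simp add: Pset_iff power_add mult_ac o_def)
    \<comment> \<open>The monomial \<open>x^(2p)\<close> comes from the largest part of
      \<open>hook_ext p lam\<close> and belongs last. Moving it past \<open>p\<close> columns gives
      the sign of the added hook.\<close>
    have 4: "?sg lam * col_det (as @ ?e (2 * p) # ?vs lam @ bs)
        = ?sg (hook_ext p lam) * col_det (as @ ?us (hook_ext p lam) @ bs)" if "lam \<in> Pset p" for lam
    proof -
      have "?us (hook_ext p lam) = ?vs lam @ [?e (2 * p)]"
        by (auto simp: Suc_diff_le part_hook_ext mult_2 mult.assoc)
      then have us: "as @ ?us (hook_ext p lam) @ bs = as @ ?vs lam @ ?e (2 * p) # bs" by simp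
      have sg: "?sg (hook_ext p lam) = (-1) ^ p * ?sg lam"
        using that by (simp add: Pset_iff sum_list_hook_ext power_add)
      have "length (?vs lam) = p" by simp
      then show ?thesis
        unfolding us sg col_det_move[of as "?e (2 * p)" "?vs lam" bs] by (simp only: ac_simps)
    qed
    have "as @ map (\<lambda>j i. a i * (x i ^ j * (1 + (x i)\<^sup>2) ^ (Suc p - 1 - j))) [0..<Suc p] @ bs
        = as @ (\<lambda>i. a i * (1 + (x i)\<^sup>2) ^ p) # ws @ bs"
      unfolding upt ws_def by (simp add: mult_ac o_def)
    then have "col_det (as @ map (\<lambda>j i. a i * (x i ^ j * (1 + (x i)\<^sup>2) ^ (Suc p - 1 - j))) [0..<Suc p] @ bs)
      = (\<Sum>lam\<in>Pset p. ?sg lam * col_det (as @ ?e 0 # ?vs lam @ bs))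
      + (\<Sum>lam\<in>Pset p. ?sg lam * col_det (as @ ?e (2 * p) # ?vs lam @ bs))"
      by (simp only: 1 2)
    also have "(\<Sum>lam\<in>Pset p. ?sg lam * col_det (as @ ?e 0 # ?vs lam @ bs))
        = (\<Sum>lam\<in>Pset p. ?sg lam * col_det (as @ ?us lam @ bs))"
      using 3 by (intro sum.cong) (simp_all only: append_Cons[symmetric])
    also have "(\<Sum>lam\<in>Pset p. ?sg lam * col_det (as @ ?e (2 * p) # ?vs lam @ bs))
        = (\<Sum>lam\<in>hook_ext p ` Pset p. ?sg lam * col_det (as @ ?us lam @ bs))"
      unfolding sum.reindex[OF inj_on_hook_ext] using 4 by (intro sum.cong) (simp_all only: o_def)
    also have "(\<Sum>lam\<in>Pset p. ?sg lam * col_det (as @ ?us lam @ bs))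
        + (\<Sum>lam\<in>hook_ext p ` Pset p. ?sg lam * col_det (as @ ?us lam @ bs))
        = (\<Sum>lam\<in>Pset (Suc p). ?sg lam * col_det (as @ ?us lam @ bs))"
      unfolding Pset_Suc[OF p]
      using Pset_finite_even Pset_disjoint_hook_ext by (intro sum.union_disjoint[symmetric]) auto
    finally show ?thesis .
  qed
qed

section \<open>Homogeneous Vandermonde determinants\<close>

text \<open>A triple \<open>(s, t, a)\<close>: homogeneous coordinates \<open>s\<close>,
  \<open>t\<close> on the projective line and the weight \<open>a\<close> of the second
  block.\<close>

type_synonym 'a point = "'a \<times> 'a \<times> 'a"

fun brow :: "nat \<Rightarrow> nat \<Rightarrow> 'a::comm_ring_1 point \<Rightarrow> nat \<Rightarrow> 'a" where
  "brow p q (s, t, a) j =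
    (if j < p then s ^ j * t ^ (p - 1 - j) else a * (s ^ (j - p) * t ^ (q - 1 - (j - p))))"

definition hvand :: "nat \<Rightarrow> nat \<Rightarrow> (nat \<Rightarrow> 'a::comm_ring_1 point) \<Rightarrow> 'a" where
  "hvand p q P = det (mat (p + q) (p + q) (\<lambda>(i, j). brow p q (P i) j))"

text \<open>The determinant of two coordinate pairs: antisymmetric, and independent of both
  weights.\<close>

fun bracket :: "'a::comm_ring_1 point \<Rightarrow> 'a point \<Rightarrow> 'a" where
  "bracket (s, t, a) (s', t', a') = s' * t - t' * s"

lemma hvand_cong: "(\<And>i. i < p + q \<Longrightarrow> P i = Q i) \<Longrightarrow> hvand p q P = hvand p q Q"
  unfolding hvand_def by (rule arg_cong[of _ _ det], rule eq_matI) auto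

lemma bracket_self [simp]: "bracket P P = 0"
  by (cases P) simp

lemma det_scale_rows:
  "det (mat n n (\<lambda>(i, j). r i * f i j)) = (\<Prod>i<n. r i) * det (mat n n (\<lambda>(i, j). f i j))"
proof -
  have "(\<Prod>i<n. r i * f i (\<pi> i)) = (\<Prod>i<n. r i) * (\<Prod>i<n. f i (\<pi> i))" for \<pi>
    by (rule prod.distrib)
  moreover have "\<pi> i < n" if "\<pi> permutes {0..<n}" "i < n" for \<pi> i
    using permutes_in_image[OF that(1), of i] that(2) by simp
  ultimately show ?thesis
    by (subst (1 2) det_def'[of _ n])
      (auto simp: sum_distrib_left atLeast0LessThan mult_ac intro!: sum.cong)
qed

lemma sum_lessThan_add:
  fixes m n :: nat
  shows "(\<Sum>j<m + n. f j) = (\<Sum>j<m. f j) + (\<Sum>j<n. f (m + j))"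
  by (induction n) (simp_all add: add.assoc)

lemma prod_lessThan_add:
  fixes m n :: nat
  shows "(\<Prod>j<m + n. f j) = (\<Prod>j<m. f j) * (\<Prod>j<n. f (m + j))"
  by (induction n) (simp_all add: mult.assoc)

lemma prod_off_diagonal_Suc:
  fixes f :: "nat \<Rightarrow> nat \<Rightarrow> 'a::comm_ring_1"
  shows "(\<Prod>j<Suc n. \<Prod>k\<in>{..<Suc n} - {j}. f j k)
    = (\<Prod>k<n. f 0 (Suc k)) * (\<Prod>k<n. f (Suc k) 0) * (\<Prod>j<n. \<Prod>k\<in>{..<n} - {j}. f (Suc j) (Suc k))"
proof -
  have S: "{..<Suc n} - {0} = Suc ` {..<n}" "{..<Suc n} - {Suc j} = insert 0 (Suc ` ({..<n} - {j}))" for j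
    by (auto simp: image_iff less_Suc_eq_0_disj)
  have "(\<Prod>k\<in>{..<Suc n} - {Suc j}. f (Suc j) k) = f (Suc j) 0 * (\<Prod>k\<in>{..<n} - {j}. f (Suc j) (Suc k))" for j
    unfolding S by (subst prod.insert) (auto simp: prod.reindex)
  moreover have "(\<Prod>k\<in>{..<Suc n} - {0}. f 0 k) = (\<Prod>k<n. f 0 (Suc k))"
    unfolding S by (simp add: prod.reindex)
  ultimately show ?thesis
    by (subst prod.lessThan_Suc_shift) (simp add: prod.distrib mult_ac)
qed

text \<open>Within each block, \<open>v\<close> times a column minus \<open>u\<close> times its
  predecessor extracts the bracket with \<open>(u, v, a)\<close>. The first two rows then survive
  only in the leading column of each block, and the other rows become scaled rows of the smaller
  matrix.\<close>

lemma hvand_double_point: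
  fixes Z :: "nat \<Rightarrow> 'a::idom point"
  assumes "v \<noteq> 0"
  shows "hvand (p + 1) (q + 1) (cons2 (u, v, a) (u, v, a') Z)
    = (-1) ^ p * (a' - a) * (\<Prod>k<p + q. bracket (u, v, a) (Z k)) * hvand p q Z"
proof -
  let ?N = "2 + (p + q)"
  define P where "P = cons2 (u, v, a) (u, v, a') Z"
  define W where "W = mat ?N ?N (\<lambda>(i, j). brow (p + 1) (q + 1) (P i) j)"
  \<comment> \<open>The column operations as an upper triangular matrix. Columns \<open>0\<close>
    and \<open>p + 1\<close> lead their blocks and stay unchanged; the coefficient 0 there also
    neutralises the truncated \<open>j - 1\<close> at \<open>j = 0\<close>.\<close>
  define U where "U = mat ?N ?N (\<lambda>(k, j). (if k = j then (if j = 0 \<or> j = p + 1 then 1 else v) else 0)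
      - (if k = j - 1 then (if j = 0 \<or> j = p + 1 then 0 else u) else 0))"
  have W_carrier: "W \<in> carrier_mat ?N ?N" and U_carrier: "U \<in> carrier_mat ?N ?N"
    by (simp_all add: W_def U_def)
  then have WU_carrier: "W * U \<in> carrier_mat ?N ?N" by simp
  have WU: "(W * U) $$ (i, j) = (if j = 0 then fst (snd (P i)) ^ p
      else if j = p + 1 then snd (snd (P i)) * fst (snd (P i)) ^ q
      else bracket (u, v, a) (P i) * brow p q (P i) (if j \<le> p then j - 1 else j - 2))"
    if ij: "i < ?N" "j < ?N" for i j
  proof -
    obtain s t c where P: "P i = (s, t, c)" by (cases "P i")
    let ?b = "brow (p + 1) (q + 1) (P i)"
    have "(W * U) $$ (i, j) = (\<Sum>k<?N. ?b k * U $$ (k, j))"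
      using ij by (simp add: W_def U_def scalar_prod_def atLeast0LessThan)
    also have "\<dots> = (\<Sum>k<?N. (if k = j then ?b k * (if j = 0 \<or> j = p + 1 then 1 else v) else 0)
        - (if k = j - 1 then ?b k * (if j = 0 \<or> j = p + 1 then 0 else u) else 0))"
      using ij by (intro sum.cong) (auto simp: U_def algebra_simps)
    also have "\<dots> = ?b j * (if j = 0 \<or> j = p + 1 then 1 else v)
        - ?b (j - 1) * (if j = 0 \<or> j = p + 1 then 0 else u)"
      using ij by (subst sum_subtractf, subst (1 2) sum.delta) auto
    also have "\<dots> = (if j = 0 then fst (snd (P i)) ^ p
      else if j = p + 1 then snd (snd (P i)) * fst (snd (P i)) ^ q
      else bracket (u, v, a) (P i) * brow p q (P i) (if j \<le> p then j - 1 else j - 2))"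
    proof -
      consider "j = 0" | "j = p + 1" | k l where "j = Suc k" "p = Suc (k + l)"
        | k l where "j = p + 2 + k" "q = Suc (k + l)"
      proof -
        consider "j = 0" | "j = p + 1" | "1 \<le> j" "j \<le> p" | "p + 2 \<le> j" by linarith
        then show ?thesis
        proof cases
          case 3
          then show ?thesis using that(3)[of "j - 1" "p - j"] by simp
        next
          case 4
          then show ?thesis using that(4)[of "j - p - 2" "q - 1 - (j - p - 2)"] ij by simp
        qed (use that in blast)+
      qed
      then show ?thesis
        by cases (auto simp: P algebra_simps)
    qed
    finally show ?thesis .
  qed
  have det_U: "det U = v ^ (p + q)"
  proof -
    have "upper_triangular U" unfolding upper_triangular_def U_def by auto
    then have "det U = prod_list (diag_mat U)" using U_carrier by (rule det_upper_triangular)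
    also have "\<dots> = (\<Prod>j<Suc (p + Suc q). if j = 0 \<or> j = p + 1 then 1 else v)"
      unfolding prod_list_diag_prod U_def by (rule prod.cong) auto
    also have "\<dots> = v ^ (p + q)"
      by (simp only: prod.lessThan_Suc_shift prod_lessThan_add) (simp add: power_add)
    finally show ?thesis .
  qed
  let ?A1 = "mat 2 2 (\<lambda>(i, j). if j = 0 then snd (snd (P i)) * v ^ q else v ^ p)"
  let ?A3 = "mat (p + q) 2 (\<lambda>(i, j). if j = 0 then snd (snd (Z i)) * fst (snd (Z i)) ^ q
                  else fst (snd (Z i)) ^ p)"
  let ?A4 = "mat (p + q) (p + q) (\<lambda>(i, j). bracket (u, v, a) (Z i) * brow p q (Z i) j)"
  have P_simps: "P 0 = (u, v, a)" "P (Suc 0) = (u, v, a')" "P (Suc (Suc k)) = Z k" for k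
    by (simp_all add: P_def cons2_def)
  \<comment> \<open>Moving column \<open>p + 1\<close> to the front puts both leading columns first,
    which makes the matrix block lower triangular. The upper left block contributes the power of
    \<open>v\<close> that cancels \<open>det U\<close>.\<close>
  have "swap_col_to_front (W * U) (p + 1) = four_block_mat ?A1 (0\<^sub>m 2 (p + q)) ?A3 ?A4"
  proof (subst swap_col_to_front_result[OF WU_carrier], simp, rule eq_matI, goal_cases)
    case (1 i j)
    then have ij: "i < ?N" "j < ?N" by auto
    have j_cases: "j = 0 \<or> j = Suc 0 \<or> (\<exists>l. j = Suc (Suc l))" by (metis not0_implies_Suc)
    consider "i = 0" | "i = Suc 0" | k where "i = Suc (Suc k)" by (metis not0_implies_Suc)
    then show ?case
      by cases (use ij j_cases in \<open>auto simp: WU P_simps\<close>)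
  qed auto
  then have "(-1) ^ (p + 1) * det (W * U) = det (four_block_mat ?A1 (0\<^sub>m 2 (p + q)) ?A3 ?A4)"
    using swap_col_to_front_det[OF WU_carrier, of "p + 1"] by simp
  also have "\<dots> = det ?A1 * det ?A4"
    by (rule det_four_block_mat_upper_right_zero[of _ 2 _ "p + q"]) auto
  also have "det ?A1 = (a - a') * v ^ (p + q)"
    by (subst laplace_expansion_row[of _ 2 0])
      (auto simp: numeral_2_eq_2 cofactor_def mat_delete_def det_single P_simps power_add algebra_simps)
  also have "det ?A4 = (\<Prod>k<p + q. bracket (u, v, a) (Z k)) * hvand p q Z"
    by (simp add: det_scale_rows hvand_def)
  finally have "v ^ (p + q) * det W
      = v ^ (p + q) * ((-1) ^ p * (a' - a) * (\<Prod>k<p + q. bracket (u, v, a) (Z k)) * hvand p q Z)"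
    unfolding det_mult[OF W_carrier U_carrier] det_U by (cases "even p") (simp_all add: algebra_simps)
  moreover have "hvand (p + 1) (q + 1) P = det W" by (simp add: hvand_def W_def)
  ultimately show ?thesis using assms by (simp add: P_def)
qed

lemma hvand_row_to_front:
  assumes "l < p + q"
  shows "hvand p q (\<lambda>i. if i = 0 then P l else if i \<le> l then P (i - 1) else P i)
    = (-1) ^ l * hvand p q P"
proof -
  let ?M = "mat (p + q) (p + q) (\<lambda>(i, j). brow p q (P i) j)"
  have "hvand p q (\<lambda>i. if i = 0 then P l else if i \<le> l then P (i - 1) else P i)
    = det (swap_row_to_front ?M l)"
    unfolding hvand_def using assms
    by (subst swap_row_to_front_result[of _ "p + q" "p + q"])
      (auto intro!: arg_cong[of _ _ det] eq_matI)
  then show ?thesis using assms swap_row_to_front_det[of ?M "p + q" l] by (simp add: hvand_def)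
qed

text \<open>Induction on \<open>n\<close>: the two rows of point 0, whose weights differ by 1, are
  removed with \<open>hvand_double_point\<close>. Each remaining doubled point contributes its
  bracket twice, since brackets ignore weights.\<close>

lemma hvand_doubled_points:
  fixes s t b :: "nat \<Rightarrow> 'a::idom" and Z :: "nat \<Rightarrow> 'a point"
  assumes "\<And>j. j < n \<Longrightarrow> t j \<noteq> 0"
  shows "hvand (n + p) (n + q)
      (concat3 n (\<lambda>j. (s j, t j, b j + 1)) (\<lambda>j. (s j, t j, b j)) Z)
    = (-1) ^ (n * (n - 1) div 2)
      * (\<Prod>j<n. \<Prod>k\<in>{..<n} - {j}. bracket (s j, t j, b j) (s k, t k, b k))
      * (\<Prod>j<n. (-1) ^ Suc p * (\<Prod>k<p + q. bracket (s j, t j, b j) (Z k))) * hvand p q Z"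
  using assms
proof (induction n arbitrary: s t b)
  case 0
  then show ?case by (simp add: concat3_def)
next
  case (Suc n)
  let ?Y = "\<lambda>j. (s j, t j, b j)"
  let ?Y' = "\<lambda>j. (s j, t j, b j + 1)"
  let ?P = "concat3 (Suc n) ?Y' ?Y Z"
  let ?Q = "concat3 n (\<lambda>j. ?Y' (Suc j)) (\<lambda>j. ?Y (Suc j)) Z"
  let ?B = "\<lambda>P. bracket (?Y 0) P"
  \<comment> \<open>Row \<open>Suc n\<close>, which holds \<open>?Y 0\<close>, goes to the front,
    and \<open>?Y' 0\<close> slides from row 0 to row 1; hence the order in
    \<open>cons2\<close>.\<close>
  have "hvand (Suc n + p) (Suc n + q) (cons2 (?Y 0) (?Y' 0) ?Q)
      = hvand (Suc n + p) (Suc n + q)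
        (\<lambda>i. if i = 0 then ?P (Suc n) else if i \<le> Suc n then ?P (i - 1) else ?P i)"
  proof (rule hvand_cong, goal_cases)
    case (1 i)
    consider "i = 0" | "i = Suc 0" | k where "i = Suc (Suc k)" by (metis not0_implies_Suc)
    then show ?case by cases (auto simp: cons2_def concat3_def Suc_diff_le)
  qed
  also have "\<dots> = (-1) ^ Suc n * hvand (Suc n + p) (Suc n + q) ?P"
    by (rule hvand_row_to_front) simp
  finally have "hvand (Suc n + p) (Suc n + q) ?P
      = (-1) ^ Suc n * hvand (n + p + 1) (n + q + 1) (cons2 (?Y 0) (?Y' 0) ?Q)"
    by (simp add: power_add[symmetric] mult.assoc[symmetric])
  also have "hvand (n + p + 1) (n + q + 1) (cons2 (?Y 0) (?Y' 0) ?Q)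
      = (-1) ^ (n + p) * (\<Prod>k<n + p + (n + q). ?B (?Q k)) * hvand (n + p) (n + q) ?Q"
    by (subst hvand_double_point) (use Suc.prems in auto)
  also have "(\<Prod>k<n + p + (n + q). ?B (?Q k))
      = (\<Prod>k<n. ?B (?Y (Suc k))) * (\<Prod>k<n. ?B (?Y (Suc k))) * (\<Prod>k<p + q. ?B (Z k))"
  proof -
    have "n + p + (n + q) = n + (n + (p + q))" by simp
    then show ?thesis
      unfolding prod_lessThan_add \<open>n + p + (n + q) = n + (n + (p + q))\<close>
      by (simp add: concat3_def mult.assoc)
  qed
  also have "hvand (n + p) (n + q) ?Q = (-1) ^ (n * (n - 1) div 2)
      * (\<Prod>j<n. \<Prod>k\<in>{..<n} - {j}. bracket (?Y (Suc j)) (?Y (Suc k)))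
      * (\<Prod>j<n. (-1) ^ Suc p * (\<Prod>k<p + q. bracket (?Y (Suc j)) (Z k))) * hvand p q Z"
    by (rule Suc.IH) (use Suc.prems in auto)
  finally have 1: "hvand (Suc n + p) (Suc n + q) ?P = (-1) ^ Suc n * ((-1) ^ (n + p)
      * ((\<Prod>k<n. ?B (?Y (Suc k))) * (\<Prod>k<n. ?B (?Y (Suc k))) * (\<Prod>k<p + q. ?B (Z k)))
      * ((-1) ^ (n * (n - 1) div 2)
      * (\<Prod>j<n. \<Prod>k\<in>{..<n} - {j}. bracket (?Y (Suc j)) (?Y (Suc k)))
      * (\<Prod>j<n. (-1) ^ Suc p * (\<Prod>k<p + q. bracket (?Y (Suc j)) (Z k))) * hvand p q Z))" .
  \<comment> \<open>One of the two equal products is rewritten with reversed brackets; the sign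
    \<open>(-1)^n\<close> is the increment of the exponent \<open>n * (n - 1) div 2\<close>.\<close>
  have 2: "(\<Prod>k<n. bracket (?Y (Suc k)) (?Y 0)) = (-1) ^ n * (\<Prod>k<n. ?B (?Y (Suc k)))"
  proof -
    have "(\<Prod>k<n. bracket (?Y (Suc k)) (?Y 0)) = (\<Prod>k<n. - 1 * ?B (?Y (Suc k)))"
      by (rule prod.cong) (simp_all add: mult.commute)
    then show ?thesis by (simp only: prod.distrib prod_constant card_lessThan)
  qed
  have "Suc n * (Suc n - 1) div 2 = n * (n - 1) div 2 + n"
  proof (cases n)
    case (Suc m)
    have "Suc n * n = n * (n - 1) + n * 2" using Suc by (simp add: algebra_simps)
    then show ?thesis by simp
  qed simp
  then have 3: "(-1) ^ (Suc n * (Suc n - 1) div 2) = (-1) ^ (n * (n - 1) div 2) * (-1 :: 'a) ^ n"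
    by (simp only: power_add)
  have 4: "(-1) ^ Suc n * (-1) ^ (n + p) = (-1 :: 'a) ^ Suc p"
    by (simp add: power_add)
  have 5: "(-1) ^ n * (-1 :: 'a) ^ n = 1" by (simp add: power_add[symmetric])
  have sign_arrange: "u * (v * (K * K * L) * (w * A * B * F)) = w * e * (K * (e * K) * A) * (g * L * B) * F"
    if "u * v = g" "e * e = 1" for u v w e g K L A B F :: 'a
  proof -
    have "w * e * (K * (e * K) * A) * (g * L * B) * F = (e * e) * (g * (K * K * L * (w * A * B * F)))"
      by (simp only: ac_simps)
    then show ?thesis unfolding that(2) that(1)[symmetric] by (simp only: ac_simps mult_1)
  qed
  show ?case
    unfolding 1 prod_off_diagonal_Suc 2 3 prod.lessThan_Suc_shift[where n = n and g = "\<lambda>j. (-1) ^ Suc p * (\<Prod>k<p + q. bracket (?Y j) (Z k))"]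
    by (rule sign_arrange[OF 4 5])
qed

section \<open>Points in general position\<close>

text \<open>For \<open>w = (s, t, a)\<close>: a form of degree \<open>p - 1\<close> in
  \<open>s\<close>, \<open>t\<close> plus \<open>a\<close> times a form of degree
  \<open>q - 1\<close>, with coefficients independent of \<open>w\<close>.\<close>

definition bform :: "nat \<Rightarrow> nat \<Rightarrow> ('a::comm_ring_1 point \<Rightarrow> 'a) \<Rightarrow> bool" where
  "bform p q f \<longleftrightarrow> (\<exists>e. \<forall>w. f w = (\<Sum>j<p + q. brow p q w j * e j))"

text \<open>The bracket is linear in the coordinates of \<open>w\<close> and free of its weight, so
  it raises both degrees by one.\<close>

lemma bform_mult_bracket:
  assumes "bform p q f"
  shows "bform (Suc p) (Suc q) (\<lambda>w. f w * bracket w Y)"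
proof -
  obtain u v y where Y: "Y = (u, v, y)" by (cases Y)
  obtain e where e: "\<And>w. f w = (\<Sum>j<p + q. brow p q w j * e j)" using assms by (auto simp: bform_def)
  have shift: "(\<Sum>j<m. s ^ j * t ^ (m - 1 - j) * d j) * (u * t - v * s)
      = (\<Sum>j<Suc m. s ^ j * t ^ (m - j) * ((if j < m then u * d j else 0) - (if j = 0 then 0 else v * d (j - 1))))"
    for m and s t :: 'a and d
  proof -
    have "(\<Sum>j<Suc m. s ^ j * t ^ (m - j) * (if j < m then u * d j else 0))
        = (\<Sum>j<m. s ^ j * t ^ (m - 1 - j) * d j * (u * t))"
    proof -
      have "t ^ (m - j) = t * t ^ (m - 1 - j)" if "j < m" for j
      proof -
        have "m - j = Suc (m - 1 - j)" using that by simp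
        then show ?thesis by (simp only: power_Suc)
      qed
      then show ?thesis by (simp add: mult_ac)
    qed
    moreover have "(\<Sum>j<Suc m. s ^ j * t ^ (m - j) * (if j = 0 then 0 else v * d (j - 1)))
        = (\<Sum>j<m. s ^ j * t ^ (m - 1 - j) * d j * (v * s))"
      by (subst sum.lessThan_Suc_shift) (simp add: mult_ac)
    ultimately show ?thesis
      by (simp only: right_diff_distrib sum_subtractf sum_distrib_right)
  qed
  define g where "g m d j = (if j < m then u * d j else 0) - (if j = 0 then 0 else v * d (j - 1))"
    for m :: nat and d :: "nat \<Rightarrow> 'a" and j
  have "f w * bracket w Y = (\<Sum>j<Suc p + Suc q. brow (Suc p) (Suc q) w j *
      (if j < Suc p then g p e j else g q (\<lambda>j. e (p + j)) (j - Suc p)))" for w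
  proof -
    obtain s t a where w: "w = (s, t, a)" by (cases w)
    have "f w = (\<Sum>j<p. s ^ j * t ^ (p - 1 - j) * e j)
        + a * (\<Sum>j<q. s ^ j * t ^ (q - 1 - j) * e (p + j))"
      unfolding e sum_lessThan_add by (simp add: w sum_distrib_left mult.assoc)
    then have "f w * bracket w Y = (\<Sum>j<p. s ^ j * t ^ (p - 1 - j) * e j) * (u * t - v * s)
        + a * ((\<Sum>j<q. s ^ j * t ^ (q - 1 - j) * e (p + j)) * (u * t - v * s))"
      by (simp add: w Y algebra_simps)
    also have "\<dots> = (\<Sum>j<Suc p. s ^ j * t ^ (p - j) * g p e j)
        + a * (\<Sum>j<Suc q. s ^ j * t ^ (q - j) * g q (\<lambda>j. e (p + j)) j)"
      unfolding shift g_def ..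
    also have "\<dots> = (\<Sum>j<Suc p + Suc q. brow (Suc p) (Suc q) w j *
      (if j < Suc p then g p e j else g q (\<lambda>j. e (p + j)) (j - Suc p)))"
      unfolding sum_lessThan_add by (simp add: w sum_distrib_left mult.assoc del: sum.lessThan_Suc)
    finally show ?thesis .
  qed
  then show ?thesis unfolding bform_def
    by (intro exI[of _ "\<lambda>j. if j < Suc p then g p e j else g q (\<lambda>j. e (p + j)) (j - Suc p)"] allI)
qed

lemma bform_mult_brackets:
  assumes "bform p q f" "finite S"
  shows "bform (p + card S) (q + card S) (\<lambda>w. f w * (\<Prod>k\<in>S. bracket w (Y k)))"
  using assms(2)
proof (induction S)
  case empty
  then show ?case using assms(1) by simp
next
  case (insert k S)
  have "(\<lambda>w. f w * (\<Prod>k\<in>insert k S. bracket w (Y k)))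
      = (\<lambda>w. f w * (\<Prod>k\<in>S. bracket w (Y k)) * bracket w (Y k))"
    using insert.hyps by (simp add: mult_ac)
  then show ?case using bform_mult_bracket[OF insert.IH, of "Y k"] insert.hyps by simp
qed

text \<open>Expansion along row 0, whose cofactors do not involve \<open>w\<close>;
  \<open>M y\<close> merely supplies them.\<close>

lemma bform_hvand: "bform (Suc p) (Suc q) (\<lambda>w. hvand (Suc p) (Suc q) (cons2 w y Z))"
proof -
  let ?N = "Suc p + Suc q"
  define M where "M w = mat ?N ?N (\<lambda>(i, j). brow (Suc p) (Suc q) (cons2 w y Z i) j)" for w
  have M: "M w \<in> carrier_mat ?N ?N" for w by (simp add: M_def)
  have "hvand (Suc p) (Suc q) (cons2 w y Z)
      = (\<Sum>j<?N. brow (Suc p) (Suc q) w j * cofactor (M y) 0 j)" for w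
  proof -
    have "cofactor (M w) 0 j = cofactor (M y) 0 j" for j
    proof -
      have "mat_delete (M w) 0 j = mat_delete (M y) 0 j"
        by (rule eq_matI) (auto simp: mat_delete_def M_def cons2_def)
      then show ?thesis by (simp add: cofactor_def)
    qed
    moreover have "M w $$ (0, j) = brow (Suc p) (Suc q) w j" if "j < ?N" for j
      using that by (simp add: M_def cons2_def)
    moreover have "hvand (Suc p) (Suc q) (cons2 w y Z) = det (M w)"
      by (simp only: hvand_def M_def)
    ultimately show ?thesis
      using laplace_expansion_row[OF M, of 0 w] by (simp del: sum.lessThan_Suc)
  qed
  then show ?thesis unfolding bform_def by blast
qed

lemma hvand_eq_0:
  assumes "i < p + q" "j < p + q" "i \<noteq> j" "P i = P j"
  shows "hvand p q P = 0"
  unfolding hvand_def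
  by (rule det_identical_rows[OF _ assms(3,1,2)]) (use assms in \<open>auto simp: row_def\<close>)


text \<open>One matrix \<open>H\<close> is multiplied by the row matrix \<open>W\<close> of
  \<open>X, Y, Z\<close> and by the row matrix \<open>R\<close> of \<open>Y', Y, Z\<close>. Both
  products are block triangular, and eliminating \<open>det H\<close> compares the two
  determinants.\<close>

lemma hvand_det_generic:
  fixes X Y Z :: "nat \<Rightarrow> 'a::idom point"
  assumes n: "1 \<le> n"
    and tY: "\<And>j. j < n \<Longrightarrow> fst (snd (Y j)) \<noteq> 0"
    and YY: "\<And>j k. j < n \<Longrightarrow> k < n \<Longrightarrow> j \<noteq> k \<Longrightarrow> bracket (Y j) (Y k) \<noteq> 0"
    and YZ: "\<And>j k. j < n \<Longrightarrow> k < p + q \<Longrightarrow> bracket (Y j) (Z k) \<noteq> 0"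
    and Z: "hvand p q Z \<noteq> 0"
  shows "det (mat n n (\<lambda>(i, j). hvand (p + 1) (q + 1) (cons2 (X i) (Y j) Z)
            * (\<Prod>k\<in>{..<n} - {j}. bracket (X i) (Y k))))
       = (-1) ^ (n * (n - 1) div 2) * hvand p q Z ^ (n - 1) * hvand (n + p) (n + q) (concat3 n X Y Z)"
proof -
  define s t b where "s j = fst (Y j)" and "t j = fst (snd (Y j))" and "b j = snd (snd (Y j))" for j
  have Y: "Y = (\<lambda>j. (s j, t j, b j))" by (simp add: s_def t_def b_def)
  \<comment> \<open>Raising only the weight keeps the brackets with all \<open>Y k\<close>, so
    \<open>f j\<close> vanishes at \<open>Y' i\<close> for \<open>i \<noteq> j\<close>, while the
    rows of \<open>Y' j\<close> and \<open>Y j\<close> can remain independent.\<close>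
  define Y' where "Y' = (\<lambda>j. (s j, t j, b j + 1))"
  define m where "m = n + p + q"
  have N: "(n + p) + (n + q) = n + m" by (simp add: m_def)
  let ?row = "brow (n + p) (n + q)"
  define W where "W = mat (n + m) (n + m) (\<lambda>(i, j). ?row (concat3 n X Y Z i) j)"
  define R where "R = mat (n + m) (n + m) (\<lambda>(i, j). ?row (concat3 n Y' Y Z i) j)"
  have W_carrier: "W \<in> carrier_mat (n + m) (n + m)" and R_carrier: "R \<in> carrier_mat (n + m) (n + m)"
    by (simp_all add: W_def R_def)
  have detW: "det W = hvand (n + p) (n + q) (concat3 n X Y Z)"
    and detR: "det R = hvand (n + p) (n + q) (concat3 n Y' Y Z)"
    by (simp_all add: W_def R_def hvand_def N)
  define f where "f j w = hvand (p + 1) (q + 1) (cons2 w (Y j) Z) * (\<Prod>k\<in>{..<n} - {j}. bracket w (Y k))"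
    for j w
  have "bform (n + p) (n + q) (f j)" if "j < n" for j
  proof -
    have "card ({..<n} - {j}) = n - 1" using that by simp
    moreover have "Suc p + (n - 1) = n + p" "Suc q + (n - 1) = n + q" using n by auto
    moreover have "f j = (\<lambda>w. hvand (Suc p) (Suc q) (cons2 w (Y j) Z) * (\<Prod>k\<in>{..<n} - {j}. bracket w (Y k)))"
      by (simp add: f_def fun_eq_iff)
    ultimately show ?thesis
      using bform_mult_brackets[OF bform_hvand[of p q "Y j" Z], of "{..<n} - {j}" Y]
      by (simp only: finite_Diff finite_lessThan)
  qed
  then obtain h where h: "\<And>j w. j < n \<Longrightarrow> f j w = (\<Sum>i<n + m. ?row w i * h j i)"
    unfolding bform_def N by metis
  \<comment> \<open>The first \<open>n\<close> columns are the coefficient vectors of the forms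
    \<open>f j\<close>. The others come from the adjugate of \<open>R\<close>, which plays the role
    of an inverse without division.\<close>
  define H where "H = mat (n + m) (n + m) (\<lambda>(i, j). if j < n then h j i else adj_mat R $$ (i, j))"
  have H_carrier: "H \<in> carrier_mat (n + m) (n + m)" by (simp add: H_def)
  have mult_left: "(mat (n + m) (n + m) (\<lambda>(i, j). ?row (P i) j) * H) $$ (i, j) = f j (P i)"
    if "i < n + m" "j < n" for P i j
    using that h[OF that(2), of "P i"] by (simp add: H_def scalar_prod_def atLeast0LessThan)
  have adj: "R * adj_mat R = det R \<cdot>\<^sub>m 1\<^sub>m (n + m)" "adj_mat R \<in> carrier_mat (n + m) (n + m)"
    using adj_mat[OF R_carrier] by auto
  have R_right: "(R * H) $$ (i, j) = (if i = j then det R else 0)" if "i < n + m" "n \<le> j" "j < n + m" for i j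
  proof -
    have "(R * H) $$ (i, j) = (R * adj_mat R) $$ (i, j)"
      using that R_carrier adj(2) by (auto simp: H_def scalar_prod_def)
    then show ?thesis using that by (simp add: adj(1))
  qed
  have W_right: "(W * H) $$ (i, j) = (R * H) $$ (i, j)" if "n \<le> i" "i < n + m" "j < n + m" for i j
    using that H_carrier by (auto simp: W_def R_def scalar_prod_def concat3_def)
  define d where "d j = f j (Y' j)" for j
  have f_Y': "f j (Y' i) = (if i = j then d j else 0)" if "i < n" "j < n" for i j
  proof (cases "i = j")
    case False
    have "bracket (Y' i) (Y i) = 0" by (simp add: Y'_def Y)
    then have "(\<Prod>k\<in>{..<n} - {j}. bracket (Y' i) (Y k)) = 0"
      using that False by (intro prod_zero) auto
    then show ?thesis using False by (simp add: f_def)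
  qed (simp add: d_def)
  have f_Y: "f j (Y i) = 0" if "i < n" "j < n" for i j
  proof (cases "i = j")
    case True
    have "hvand (p + 1) (q + 1) (cons2 (Y j) (Y j) Z) = 0"
      by (rule hvand_eq_0[of 0 _ _ 1]) (auto simp: cons2_def)
    then show ?thesis using True by (simp add: f_def)
  next
    case False
    then have "(\<Prod>k\<in>{..<n} - {j}. bracket (Y i) (Y k)) = 0"
      using that by (intro prod_zero) (auto intro!: bexI[of _ i])
    then show ?thesis by (simp add: f_def)
  qed
  have f_Z: "f j (Z k) = 0" if "k < p + q" for j k
  proof -
    have "hvand (p + 1) (q + 1) (cons2 (Z k) (Y j) Z) = 0"
      by (rule hvand_eq_0[of 0 _ _ "Suc (Suc k)"]) (use that in \<open>auto simp: cons2_def\<close>)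
    then show ?thesis by (simp add: f_def)
  qed
  have f_low: "f j (concat3 n P Y Z i) = 0" if "n \<le> i" "i < n + m" "j < n" for P i j
    using that f_Y[of "i - n" j] f_Z[of "i - 2 * n" j] by (auto simp: concat3_def m_def)
  let ?D = "mat n n (\<lambda>(i, j). if i = j then d j else 0)"
  let ?M = "mat n n (\<lambda>(i, j). f j (X i))"
  let ?I = "det R \<cdot>\<^sub>m 1\<^sub>m m"
  have "R * H = four_block_mat ?D (0\<^sub>m n m) (0\<^sub>m m n) ?I"
  proof (rule eq_matI, goal_cases)
    case (1 i j)
    then have ij: "i < n + m" "j < n + m" by auto
    show ?case
    proof (cases "j < n")
      case True
      have "(R * H) $$ (i, j) = f j (concat3 n Y' Y Z i)"
        unfolding R_def using mult_left ij True by blast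
      then show ?thesis
        using ij True f_low[of i j Y'] f_Y'[of i j] by (auto simp: concat3_def)
    next
      case False
      then show ?thesis using R_right[of i j] ij by auto
    qed
  qed (use R_carrier H_carrier in auto)
  then have "det (R * H) = det ?D * det ?I"
    using det_four_block_mat_lower_left_zero[of ?D n "0\<^sub>m n m" m "0\<^sub>m m n" ?I] by simp
  moreover have "det ?D = (\<Prod>j<n. d j)"
  proof -
    have "det ?D = prod_list (diag_mat ?D)"
      by (rule det_upper_triangular[of _ n]) auto
    also have "\<dots> = (\<Prod>j<n. d j)"
      unfolding prod_list_diag_prod by (rule prod.cong) auto
    finally show ?thesis .
  qed
  ultimately have RH: "det R * det H = (\<Prod>j<n. d j) * det R ^ m"
    using det_mult[OF R_carrier H_carrier] by simp
  have "W * H = four_block_mat ?M (mat n m (\<lambda>(i, j). (W * H) $$ (i, n + j))) (0\<^sub>m m n) ?I"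
  proof (rule eq_matI, goal_cases)
    case (1 i j)
    then have ij: "i < n + m" "j < n + m" by auto
    show ?case
    proof (cases "j < n")
      case True
      have "(W * H) $$ (i, j) = f j (concat3 n X Y Z i)"
        unfolding W_def using mult_left ij True by blast
      then show ?thesis
        using ij True f_low[of i j X] by (auto simp: concat3_def)
    next
      case False
      then show ?thesis using R_right[of i j] W_right[of i j] ij by auto
    qed
  qed (use W_carrier H_carrier in auto)
  then have "det (W * H) = det ?M * det ?I"
    using det_four_block_mat_lower_left_zero[of ?M n "mat n m (\<lambda>(i, j). (W * H) $$ (i, n + j))" m "0\<^sub>m m n" ?I]
    by simp
  then have WH: "det W * det H = det ?M * det R ^ m"
    using det_mult[OF W_carrier H_carrier] by simp
  define A where "A = (\<Prod>j<n. \<Prod>k\<in>{..<n} - {j}. bracket (Y j) (Y k))"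
  define B where "B = (\<Prod>j<n. (-1) ^ Suc p * (\<Prod>k<p + q. bracket (Y j) (Z k)))"
  have AB: "A \<noteq> 0" "B \<noteq> 0" using YY YZ by (auto simp: A_def B_def)
  have R: "det R = (-1) ^ (n * (n - 1) div 2) * A * B * hvand p q Z"
    unfolding detR Y'_def Y A_def B_def
    by (rule hvand_doubled_points) (use tY in \<open>simp add: t_def\<close>)
  then have R0: "det R \<noteq> 0" using AB Z by simp
  \<comment> \<open>Here the weight \<open>b j + 1\<close> comes first, so the weight difference in
    \<open>hvand_double_point\<close> is -1; hence \<open>Suc p\<close> in the exponent.\<close>
  have "d j = (\<Prod>k\<in>{..<n} - {j}. bracket (Y j) (Y k))
      * ((-1) ^ Suc p * (\<Prod>k<p + q. bracket (Y j) (Z k))) * hvand p q Z" if "j < n" for j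
  proof -
    have br: "bracket (s j, t j, b j + 1) P = bracket (s j, t j, b j) P" for P by (cases P) simp
    have "hvand (p + 1) (q + 1) (cons2 (Y' j) (Y j) Z)
        = (-1) ^ Suc p * (\<Prod>k<p + q. bracket (Y j) (Z k)) * hvand p q Z"
      unfolding Y Y'_def using tY[OF that, folded t_def] by (subst hvand_double_point) (simp_all add: br)
    then show ?thesis unfolding d_def f_def
      by (simp add: Y'_def Y br mult_ac)
  qed
  then have "(\<Prod>j<n. d j) = A * B * (\<Prod>j<n. hvand p q Z)"
    unfolding A_def B_def prod.distrib[symmetric] by (intro prod.cong refl) (simp only: lessThan_iff)
  also have "(\<Prod>j<n. hvand p q Z) = hvand p q Z ^ n" by simp
  also have "hvand p q Z ^ n = hvand p q Z * hvand p q Z ^ (n - 1)"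
    using n by (metis power_eq_if not_one_le_zero)
  finally have d: "(\<Prod>j<n. d j) = A * B * (hvand p q Z * hvand p q Z ^ (n - 1))" .
  \<comment> \<open>Cross-multiplying \<open>RH\<close> and \<open>WH\<close> eliminates
    \<open>det H\<close>, which need not be computed or known to be nonzero.\<close>
  have "det R * (det ?M * det R ^ m) = det W * ((\<Prod>j<n. d j) * det R ^ m)"
    unfolding RH[symmetric] WH[symmetric] by (simp add: mult_ac)
  then have "det R * det ?M = det W * (\<Prod>j<n. d j)" using R0 by simp
  moreover have "(\<Prod>j<n. d j) = (-1) ^ (n * (n - 1) div 2) * hvand p q Z ^ (n - 1) * det R"
  proof -
    let ?e = "(-1) ^ (n * (n - 1) div 2) :: 'a"
    have 1: "?e * hvand p q Z ^ (n - 1) * det R = (?e * ?e) * (A * B * (hvand p q Z * hvand p q Z ^ (n - 1)))"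
      unfolding R by (simp only: ac_simps)
    have 2: "?e * ?e = 1" by (simp add: power_mult_distrib[symmetric])
    show ?thesis unfolding d 1 2 mult_1 ..
  qed
  ultimately have "det R * det ?M = det R * ((-1) ^ (n * (n - 1) div 2) * hvand p q Z ^ (n - 1) * det W)"
    by (simp add: mult_ac)
  then show ?thesis using R0 by (simp add: f_def detW)
qed


section \<open>Specialisation\<close>

definition map_point :: "('a \<Rightarrow> 'b) \<Rightarrow> 'a point \<Rightarrow> 'b point" where
  "map_point h = map_prod h (map_prod h h)"

lemma map_point_simps [simp]: "map_point h (s, t, a) = (h s, h t, h a)"
  by (simp add: map_point_def)

lemma map_point_cons2: "map_point h (cons2 u v Z i) = cons2 (map_point h u) (map_point h v) (\<lambda>k. map_point h (Z k)) i"
  by (simp add: cons2_def)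

lemma map_point_concat3:
  "map_point h (concat3 n X Y Z i)
    = concat3 n (\<lambda>k. map_point h (X k)) (\<lambda>k. map_point h (Y k)) (\<lambda>k. map_point h (Z k)) i"
  by (simp add: concat3_def)

context comm_ring_hom
begin

lemma hom_brow: "hom (brow p q w j) = brow p q (map_point hom w) j"
  by (cases w) (simp add: hom_distribs)

lemma hom_bracket: "hom (bracket v w) = bracket (map_point hom v) (map_point hom w)"
  by (cases v; cases w) (simp add: hom_distribs)

lemma hom_hvand: "hom (hvand p q P) = hvand p q (\<lambda>i. map_point hom (P i))"
  unfolding hvand_def hom_det[symmetric]
  by (rule arg_cong[of _ _ det], rule eq_matI) (auto simp: hom_brow)

end

text \<open>With these weights the matrix is block lower triangular with Vandermonde diagonal
  blocks. A kernel vector gives, block by block, a polynomial with more roots than its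
  degree.\<close>

lemma hvand_nonzero:
  fixes r :: "nat \<Rightarrow> 'a::idom"
  assumes "inj r"
  shows "hvand p q (\<lambda>k. (r k, 1, if k < p then 0 else 1)) \<noteq> 0"
proof
  let ?P = "\<lambda>k. (r k, 1, if k < p then 0 else 1)"
  let ?M = "mat (p + q) (p + q) (\<lambda>(i, j). brow p q (?P i) j)"
  assume "hvand p q ?P = 0"
  then obtain v where v: "v \<in> carrier_vec (p + q)" "v \<noteq> 0\<^sub>v (p + q)" "?M *\<^sub>v v = 0\<^sub>v (p + q)"
    using det_0_iff_vec_prod_zero[of ?M "p + q"] by (auto simp: hvand_def)
  have zero: "(\<Sum>j<p. r i ^ j * v $ j) + (if i < p then 0 else \<Sum>j<q. r i ^ j * v $ (p + j)) = 0"
    if "i < p + q" for i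
  proof -
    have "0 = (?M *\<^sub>v v) $ i" unfolding v(3) using that by simp
    also have "\<dots> = (\<Sum>j<p + q. brow p q (?P i) j * v $ j)"
      using that v(1) by (simp add: scalar_prod_def atLeast0LessThan)
    also have "\<dots> = (\<Sum>j<p. r i ^ j * v $ j) + (if i < p then 0 else \<Sum>j<q. r i ^ j * v $ (p + j))"
      unfolding sum_lessThan_add by simp
    finally show ?thesis by simp
  qed
  \<comment> \<open>The offset \<open>l\<close> selects the points of a block: 0 for the first,
    \<open>p\<close> for the second.\<close>
  have vanish: "e j = 0" if "\<And>i. i < m \<Longrightarrow> (\<Sum>j<m. r (l + i) ^ j * e j) = 0" "j < m" for m l j and e :: "nat \<Rightarrow> 'a"
  proof -
    define f where "f = (\<Sum>j<m. monom (e j) j)"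
    have coeff: "coeff f k = (if k < m then e k else 0)" for k
      by (simp add: f_def coeff_sum)
    have "f = 0"
    proof (rule ccontr)
      assume f: "f \<noteq> 0"
      have "(\<lambda>i. r (l + i)) ` {..<m} \<subseteq> {x. poly f x = 0}"
        using that(1) by (auto simp: f_def poly_sum poly_monom mult.commute)
      then have "card ((\<lambda>i. r (l + i)) ` {..<m}) \<le> card {x. poly f x = 0}"
        by (rule card_mono[OF poly_roots_finite[OF f]])
      moreover have "card ((\<lambda>i. r (l + i)) ` {..<m}) = m"
        by (subst card_image) (auto simp: inj_on_def inj_eq[OF assms])
      moreover have "degree f < m"
      proof -
        have "coeff f (degree f) \<noteq> 0" using f by simp
        then show ?thesis by (metis coeff)
      qed
      ultimately show False using card_poly_roots_bound[OF f] by simp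
    qed
    then show ?thesis using coeff[of j] that(2) by simp
  qed
  have v1: "v $ j = 0" if "j < p" for j
  proof (rule vanish[of p 0 "\<lambda>j. v $ j" j, OF _ that])
    fix i assume "i < p"
    then show "(\<Sum>j<p. r (0 + i) ^ j * v $ j) = 0" using zero[of i] by simp
  qed
  have v2: "v $ (p + j) = 0" if "j < q" for j
  proof (rule vanish[of q p "\<lambda>j. v $ (p + j)" j, OF _ that])
    fix i assume "i < q"
    then show "(\<Sum>j<q. r (p + i) ^ j * v $ (p + j)) = 0" using zero[of "p + i"] v1 by simp
  qed
  have "v $ j = 0" if "j < p + q" for j
    using v1[of j] v2[of "j - p"] that by (cases "j < p") auto
  then have "v = 0\<^sub>v (p + q)" using v(1) by (intro eq_vecI) auto
  then show False using v(2) by simp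
qed

text \<open>Free of denominators, hence a polynomial identity in the coordinates that ring
  homomorphisms preserve.\<close>

definition hvand_identity :: "nat \<Rightarrow> nat \<Rightarrow> nat \<Rightarrow> (nat \<Rightarrow> 'a::comm_ring_1 point)
    \<Rightarrow> (nat \<Rightarrow> 'a point) \<Rightarrow> (nat \<Rightarrow> 'a point) \<Rightarrow> bool" where
  "hvand_identity n p q X Y Z \<longleftrightarrow>
    det (mat n n (\<lambda>(i, j). hvand (p + 1) (q + 1) (cons2 (X i) (Y j) Z)
            * (\<Prod>k\<in>{..<n} - {j}. bracket (X i) (Y k))))
       = (-1) ^ (n * (n - 1) div 2) * hvand p q Z ^ (n - 1) * hvand (n + p) (n + q) (concat3 n X Y Z)"

lemma (in comm_ring_hom) hvand_identity_hom:
  assumes "hvand_identity n p q X Y Z"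
  shows "hvand_identity n p q (\<lambda>i. map_point hom (X i)) (\<lambda>i. map_point hom (Y i)) (\<lambda>i. map_point hom (Z i))"
proof -
  let ?M = "mat n n (\<lambda>(i, j). hvand (p + 1) (q + 1) (cons2 (X i) (Y j) Z)
            * (\<Prod>k\<in>{..<n} - {j}. bracket (X i) (Y k)))"
  have "hom (det ?M)
      = hom ((-1) ^ (n * (n - 1) div 2) * hvand p q Z ^ (n - 1) * hvand (n + p) (n + q) (concat3 n X Y Z))"
    using assms unfolding hvand_identity_def by (rule arg_cong)
  then have det_M: "hom (det ?M) = (-1) ^ (n * (n - 1) div 2) * hvand p q (\<lambda>i. map_point hom (Z i)) ^ (n - 1)
      * hvand (n + p) (n + q) (concat3 n (\<lambda>i. map_point hom (X i)) (\<lambda>i. map_point hom (Y i)) (\<lambda>i. map_point hom (Z i)))"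
    by (simp add: hom_distribs hom_hvand map_point_concat3)
  have map_M: "map_mat hom ?M
      = mat n n (\<lambda>(i, j). hvand (p + 1) (q + 1) (cons2 (map_point hom (X i)) (map_point hom (Y j)) (\<lambda>k. map_point hom (Z k)))
            * (\<Prod>k\<in>{..<n} - {j}. bracket (map_point hom (X i)) (map_point hom (Y k))))"
    by (rule eq_matI) (auto simp: hom_distribs hom_hvand hom_bracket map_point_cons2)
  show ?thesis
    unfolding hvand_identity_def map_M[symmetric] hom_det by (rule det_M)
qed

interpretation poly_hom: comm_ring_hom "\<lambda>f. poly f c" for c
  by unfold_locales simp_all

text \<open>Over the polynomial ring, \<open>Y\<close> and \<open>Z\<close> move along lines from
  the given points at parameter 0 to points in general position at parameter 1. Nonvanishing is
  checked at 1, and the identity is evaluated at 0.\<close>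

lemma hvand_identity_infinite:
  fixes r :: "nat \<Rightarrow> 'a::idom" and X Y Z :: "nat \<Rightarrow> 'a point"
  assumes "1 \<le> n" "inj r"
  shows "hvand_identity n p q X Y Z"
proof -
  define line :: "'a point \<Rightarrow> 'a point \<Rightarrow> 'a poly point" where
    "line = (\<lambda>(s, t, a) (s', t', a'). ([:s, s' - s:], [:t, t' - t:], [:a, a' - a:]))"
  define Y' where "Y' j = (r j, 1::'a, 0::'a)" for j
  \<comment> \<open>The shift by \<open>n\<close> keeps these points distinct from all
    \<open>Y' j\<close>; the weights are those of \<open>hvand_nonzero\<close>.\<close>
  define Z' where "Z' k = (r (n + k), 1::'a, if k < p then 0 else 1::'a)" for k
  have line0: "map_point (\<lambda>f. poly f 0) (line P Q) = P"
    and line1: "map_point (\<lambda>f. poly f 1) (line P Q) = Q" for P Q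
    by (cases P; cases Q; simp add: line_def)+
  have nz: "f \<noteq> 0" if "poly f 1 \<noteq> 0" for f :: "'a poly" using that by auto
  have "hvand_identity n p q (\<lambda>i. line (X i) (X i)) (\<lambda>j. line (Y j) (Y' j)) (\<lambda>k. line (Z k) (Z' k))"
    unfolding hvand_identity_def
  proof (rule hvand_det_generic[OF assms(1)])
    fix j
    have "poly (fst (snd (line (Y j) (Y' j)))) 1 = 1"
      by (cases "Y j") (simp add: line_def Y'_def)
    then show "fst (snd (line (Y j) (Y' j))) \<noteq> 0" by (intro nz) simp
  next
    fix j k assume "j < n" "k < n" "j \<noteq> k"
    then show "bracket (line (Y j) (Y' j)) (line (Y k) (Y' k)) \<noteq> 0"
      by (intro nz) (simp add: poly_hom.hom_bracket line1 Y'_def inj_eq[OF assms(2)])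
  next
    fix j k assume "j < n"
    then show "bracket (line (Y j) (Y' j)) (line (Z k) (Z' k)) \<noteq> 0"
      by (intro nz) (simp add: poly_hom.hom_bracket line1 Y'_def Z'_def inj_eq[OF assms(2)])
  next
    have "inj (\<lambda>k. r (n + k))" by (rule injI) (simp add: inj_eq[OF assms(2)])
    then show "hvand p q (\<lambda>k. line (Z k) (Z' k)) \<noteq> 0"
      by (intro nz) (simp add: poly_hom.hom_hvand line1 Z'_def hvand_nonzero)
  qed
  from poly_hom.hvand_identity_hom[OF this, where c = 0] show ?thesis by (simp add: line0)
qed

text \<open>A finite domain has no injective sequence, but its polynomial ring has the monomials.
  Points are embedded as constants and recovered by evaluation at 0.\<close>

lemma hvand_identity:
  fixes X Y Z :: "nat \<Rightarrow> 'a::idom point"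
  assumes "1 \<le> n"
  shows "hvand_identity n p q X Y Z"
proof -
  let ?c = "map_point (\<lambda>c. [:c:])"
  have "inj (monom 1 :: nat \<Rightarrow> 'a poly)" by (rule injI) (simp add: monom_eq_iff')
  then have "hvand_identity n p q (\<lambda>i. ?c (X i)) (\<lambda>i. ?c (Y i)) (\<lambda>i. ?c (Z i))"
    by (rule hvand_identity_infinite[OF assms])
  note poly_hom.hvand_identity_hom[OF this, where c = 0]
  moreover have "map_point (\<lambda>f. poly f 0) (?c P) = P" for P :: "'a point" by (cases P) simp
  ultimately show ?thesis by simp
qed

section \<open>Return to \<open>Ffun\<close> and the determinant identity\<close>

text \<open>\<open>col_det_Pset\<close> is applied to the first block with weight 1 and then to the
  second with weight \<open>a\<close>.\<close>

lemma Ffun_eq_hvand: "Ffun p q x a = hvand p q (\<lambda>i. (x i, 1 + (x i)\<^sup>2, a i))"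
proof -
  let ?w = "\<lambda>p c. map (\<lambda>j i. c i * (x i ^ j * (1 + (x i)\<^sup>2) ^ (p - 1 - j))) [0..<p]"
  let ?v = "\<lambda>p lam c. map (\<lambda>j i. c i * x i ^ (part lam (p - j) + j)) [0..<p]"
  let ?one = "\<lambda>_::nat. 1 :: 'a"
  have "hvand p q (\<lambda>i. (x i, 1 + (x i)\<^sup>2, a i)) = col_det (?w p ?one @ ?w q a)"
    unfolding hvand_def col_det_def
    by (rule arg_cong[of _ _ det], rule eq_matI) (auto simp: nth_append)
  also have "\<dots> = (\<Sum>lam\<in>Pset p. (-1) ^ (sum_list lam div 2) * col_det (?v p lam ?one @ ?w q a))"
    using col_det_Pset[of "[]" ?one x p "?w q a"] by simp
  also have "\<dots> = (\<Sum>lam\<in>Pset p. (-1) ^ (sum_list lam div 2) *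
      (\<Sum>mu\<in>Pset q. (-1) ^ (sum_list mu div 2) * col_det (?v p lam ?one @ ?v q mu a)))"
    using col_det_Pset[of _ a x q "[]"] by simp
  also have "\<dots> = Ffun p q x a"
    unfolding Ffun_def sum_distrib_left
  proof (intro sum.cong refl)
    fix lam mu assume *: "lam \<in> Pset p" "mu \<in> Pset q"
    have "col_det (?v p lam ?one @ ?v q mu a) = det (Vmat p q lam mu x a)"
      unfolding col_det_def Vmat_def
      by (rule arg_cong[of _ _ det], rule eq_matI) (auto simp: nth_append)
    moreover have "(sum_list lam + sum_list mu) div 2 = sum_list lam div 2 + sum_list mu div 2"
      using Pset_finite_even * by (metis div_plus_div_distrib_dvd_left)
    ultimately show "(-1) ^ (sum_list lam div 2) * ((-1) ^ (sum_list mu div 2) * col_det (?v p lam ?one @ ?v q mu a))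
        = (-1) ^ ((sum_list lam + sum_list mu) div 2) * det (Vmat p q lam mu x a)"
      by (simp add: power_add mult.assoc)
  qed
  finally show ?thesis by simp
qed

theorem mainTheorem1:
  fixes n p q :: nat and x y z a b c :: "nat \<Rightarrow> 'a::field"
  assumes "n \<ge> 1"
    and "\<And>i j. i < n \<Longrightarrow> j < n \<Longrightarrow> y j - x i \<noteq> 0"
    and "\<And>i j. i < n \<Longrightarrow> j < n \<Longrightarrow> 1 - x i * y j \<noteq> 0"
  shows "det (mat n n (\<lambda>(i, j).
            Ffun (p + 1) (q + 1) (cons2 (x i) (y j) z) (cons2 (a i) (b j) c)
              / ((y j - x i) * (1 - x i * y j))))
       = (-1) ^ (n * (n - 1) div 2) / (\<Prod>i<n. \<Prod>j<n. (y j - x i) * (1 - x i * y j))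
         * Ffun p q z c ^ (n - 1)
         * Ffun (n + p) (n + q) (concat3 n x y z) (concat3 n a b c)"
proof -
  define pt :: "'a \<Rightarrow> 'a \<Rightarrow> 'a point" where "pt u v = (u, 1 + u\<^sup>2, v)" for u v
  define X Y Z where "X i = pt (x i) (a i)" and "Y i = pt (y i) (b i)" and "Z i = pt (z i) (c i)" for i
  have F: "Ffun k l u v = hvand k l (\<lambda>i. pt (u i) (v i))" for k l u v
    by (simp add: Ffun_eq_hvand pt_def)
  have F_cons2: "Ffun (p + 1) (q + 1) (cons2 (x i) (y j) z) (cons2 (a i) (b j) c)
      = hvand (p + 1) (q + 1) (cons2 (X i) (Y j) Z)" for i j
    unfolding F by (rule hvand_cong) (auto simp: cons2_def X_def Y_def Z_def)
  have F_concat3: "Ffun (n + p) (n + q) (concat3 n x y z) (concat3 n a b c)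
      = hvand (n + p) (n + q) (concat3 n X Y Z)"
    unfolding F by (rule hvand_cong) (auto simp: concat3_def X_def Y_def Z_def)
  have F_Z: "Ffun p q z c = hvand p q Z"
    unfolding F by (rule hvand_cong) (simp add: Z_def)
  have br: "(y j - x i) * (1 - x i * y j) = bracket (X i) (Y j)" for i j
    by (simp add: X_def Y_def pt_def algebra_simps power2_eq_square)
  have nz: "bracket (X i) (Y j) \<noteq> 0" if "i < n" "j < n" for i j
    using assms(2,3)[OF that] by (simp flip: br)
  \<comment> \<open>Row \<open>i\<close> cleared of denominators: the factor
    \<open>(\<Prod>k<n. bracket (X i) (Y k))\<close> depends only on the row and leaves the
    determinant by \<open>det_scale_rows\<close>.\<close>
  let ?M = "\<lambda>i j. hvand (p + 1) (q + 1) (cons2 (X i) (Y j) Z) * (\<Prod>k\<in>{..<n} - {j}. bracket (X i) (Y k))"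
  have "mat n n (\<lambda>(i, j). hvand (p + 1) (q + 1) (cons2 (X i) (Y j) Z) / bracket (X i) (Y j))
      = mat n n (\<lambda>(i, j). inverse (\<Prod>k<n. bracket (X i) (Y k)) * ?M i j)"
  proof (rule eq_matI, goal_cases)
    case (1 i j)
    then have ij: "i < n" "j < n" by auto
    have "(\<Prod>k<n. bracket (X i) (Y k)) = bracket (X i) (Y j) * (\<Prod>k\<in>{..<n} - {j}. bracket (X i) (Y k))"
      using ij by (intro prod.remove) auto
    moreover have "(\<Prod>k\<in>{..<n} - {j}. bracket (X i) (Y k)) \<noteq> 0" using ij nz by auto
    ultimately show ?case using ij nz[OF ij] by (simp add: field_simps)
  qed auto
  then have "det (mat n n (\<lambda>(i, j). hvand (p + 1) (q + 1) (cons2 (X i) (Y j) Z) / bracket (X i) (Y j)))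
      = (\<Prod>i<n. inverse (\<Prod>k<n. bracket (X i) (Y k))) * det (mat n n (\<lambda>(i, j). ?M i j))"
    by (simp only: det_scale_rows)
  also have "det (mat n n (\<lambda>(i, j). ?M i j))
      = (-1) ^ (n * (n - 1) div 2) * hvand p q Z ^ (n - 1) * hvand (n + p) (n + q) (concat3 n X Y Z)"
    using hvand_identity[OF assms(1)] by (simp only: hvand_identity_def)
  also have "(\<Prod>i<n. inverse (\<Prod>k<n. bracket (X i) (Y k))) = inverse (\<Prod>i<n. \<Prod>k<n. bracket (X i) (Y k))"
    by (simp only: prod_inversef[symmetric] o_def)
  finally show ?thesis
    unfolding F_cons2 F_concat3 F_Z br by (simp only: divide_inverse ac_simps)
qed

end
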